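(* Let $k\ge2$ be an integer. The set $\{\zeta^\diamondsuit(\boldsymbol{k})\mid\boldsymbol{k}\in\mathbb{I}^{\ge2}_k\}$ is a basis of the $\mathbb{Q}$-vector space $\mathcal{Z}^\diamondsuit_k$. In particular $\dim_{\mathbb{Q}}\mathcal{Z}^\diamondsuit_k=F_{k-1}$.
   Context: $[n]=\{1,\dots,n\}$. An index is a tuple of positive integers; admissible means nonempty with last entry $\ge2$. For a positive integer $N$ and an admissible index $\boldsymbol{k}=(k_1,\dots,k_r)$, let $[r]^1_{\boldsymbol{k}}=\{i\in[r]:k_i=1\}$ and for $A\subset[r]$ let $S_{r,N}(A)=\{(n_1,\dots,n_r)\in[N-1]^r: n_i\le n_{i+1}\text{ if } i\in A,\ n_i<n_{i+1}\text{ if } i\in[r-1]\setminus A\}$. Define \[ \zeta^\diamondsuit_N(\boldsymbol{k})=\sum_{A\subset[r]^1_{\boldsymbol{k}}}\ \sum_{(n_1,\dots,n_r)\in S_{r,N}(A)}\Bigl(\prod_{i\in A}\frac1{N-n_i}\Bigr)\Bigl(\prod_{i\in[r]\setminus A}\frac1{n_i^{k_i}}\Bigr)\in\mathbb{Q}, \] and $\zeta^\diamondsuit(\boldsymbol{k})=(\zeta^\diamondsuit_N(\boldsymbol{k}))_{N\ge1}\in\mathbb{Q}^{\mathbb{N}}$ (the $\mathbb{Q}$-vector space of rational sequences). $\mathcal{Z}^\diamondsuit_k=\operatorname{span}_{\mathbb{Q}}\{\zeta^\diamondsuit(\boldsymbol{k})\mid\boldsymbol{k}\text{ admissible of weight }k\}$.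 $\mathbb{I}^{\ge2}_k$ is the set of indices of weight $k$ with all entries $\ge2$. $F_n$ is the $n$th Fibonacci number ($F_1=F_2=1$). *)

theory Defs
  imports Complex_Main "HOL-Library.Function_Algebras" "HOL-Number_Theory.Fib"
begin

text \<open>Indices are lists of naturals; positions are 0-based (position i here is i+1 in the paper).\<close>

definition is_index :: "nat list \<Rightarrow> bool" where
  "is_index ks \<longleftrightarrow> (\<forall>x\<in>set ks. 1 \<le> x)"

definition admissible :: "nat list \<Rightarrow> bool" where
  "admissible ks \<longleftrightarrow> is_index ks \<and> ks \<noteq> [] \<and> 2 \<le> last ks"

definition weight :: "nat list \<Rightarrow> nat" where
  "weight ks = sum_list ks"

definition ones_pos :: "nat list \<Rightarrow> nat set" where
  "ones_pos ks = {i. i < length ks \<and> ks ! i = 1}"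

definition S_set :: "nat \<Rightarrow> nat \<Rightarrow> nat set \<Rightarrow> nat list set" where
  "S_set r N A = {ns. length ns = r \<and> set ns \<subseteq> {1..<N} \<and>
      (\<forall>i. Suc i < r \<longrightarrow> (if i \<in> A then ns ! i \<le> ns ! Suc i else ns ! i < ns ! Suc i))}"

definition zeta_diamond_N :: "nat \<Rightarrow> nat list \<Rightarrow> rat" where
  "zeta_diamond_N N ks =
     (\<Sum>A\<in>Pow (ones_pos ks). \<Sum>ns\<in>S_set (length ks) N A.
        (\<Prod>i\<in>A. 1 / of_nat (N - ns ! i)) *
        (\<Prod>i\<in>{..<length ks} - A. 1 / (of_nat (ns ! i)) ^ (ks ! i)))"

text \<open>The sequence (zeta_N(k))_{N\<ge>1}, stored with index shift: entry m is N = m+1.\<close>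
definition zeta_diamond :: "nat list \<Rightarrow> (nat \<Rightarrow> rat)" where
  "zeta_diamond ks = (\<lambda>m. zeta_diamond_N (Suc m) ks)"

definition sscale :: "rat \<Rightarrow> (nat \<Rightarrow> rat) \<Rightarrow> (nat \<Rightarrow> rat)" where
  "sscale c f = (\<lambda>n. c * f n)"

definition Zdiamond :: "nat \<Rightarrow> (nat \<Rightarrow> rat) set" where
  "Zdiamond k = module.span sscale {zeta_diamond ks | ks. admissible ks \<and> weight ks = k}"

definition I_ge2 :: "nat \<Rightarrow> nat list set" where
  "I_ge2 k = {ks. (\<forall>x\<in>set ks. 2 \<le> x) \<and> weight ks = k}"

end

(*
Spanning. Collect the diamond sums of indices (1^a_1, k_1, ..., 1^a_d, k_d), k_i >= 2, into
generating functions in x_i (for a_i) and y_i (for k_i - 2). Let U_x^N be the operator that inserts a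
block of 1s, A_x the multiplication by 1 - x/(N-n) and M_y the multiplication by 1/(n(n-y)). Then
U_x^(N+1) = A_x U_x^N A_x^(-1), and with U = U_x, U' = U_x', A = A_x, A' = A_x' at level N,
  N(N-x'-y) U_x'^(N+1) M_y A U = N(N-x-y) A' U' M_y U + A' U' - A U.
Hence zeta_(N+1)(k) - zeta_N(k) is a combination, homogeneous in the weight, of N^(-s) zeta_N(k')
with k' admissible or empty, and the terms with s = 1 cancel. Since s >= 2, summing over N and
induction on the weight express zeta_N(k) by truncated sums all of whose entries are >= 2.

Independence. Truncated multiple harmonic sums are even independent over polynomials in N: in a
relation of minimal size, eliminating a longest word u between N and N+1 leaves a smaller relation,
whose vanishing makes a nonzero combination of the N^(-s), s >= 1, the difference of a rational
function.
*)
theory Submission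
  imports Defs "HOL-Computational_Algebra.Polynomial_Factorial"
    "HOL-Computational_Algebra.Field_as_Ring"
begin

section \<open>Linear independence of truncated multiple harmonic sums\<close>

text \<open>The conjugation by A comes from the shift m -> m + 1 in the sums over 1/(N - m): it
  turns the denominators of level N + 1 into those of level N, and A absorbs the boundary terms. The
  sums to compare are therefore those of A U, not of U. The factor N (N - x' - y) rests on N = m +
  (N - m), that is N/(m (N - m)) = 1/m + 1/(N - m). No power series are used: every identity is
  stated for one coefficient, and inverting N - x' - y becomes an induction on the exponents a + b.
  Order 2 in 1/N is the point: summing a first-order term over N would create an entry 1. A block of
  ones, on removal of one letter, contributes a first-order term; crossing the next letter outwards
  produces its negative. Only the term of the outermost block survives all inner crossings, and the
  last summation cancels it by partial fractions. Polynomial coefficients enter the independence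
  proof even for a relation with constant ones, since the elimination between N and N + 1 has to
  clear the denominators N^s.\<close>

text \<open>Words are indices read backwards: the head is the last (outermost) entry of the index.\<close>

fun mhs :: "nat list \<Rightarrow> nat \<Rightarrow> rat" where
  "mhs [] n = 1"
| "mhs (k # w) n = (\<Sum>m\<in>{1..<n}. mhs w m / of_nat m ^ k)"

section \<open>Rational functions under the shift x -> x + 1\<close>

definition pshift :: "rat poly \<Rightarrow> rat poly" where
  "pshift p = pcompose p [:1, 1:]"

lemma poly_pshift: "poly (pshift p) x = poly p (x + 1)"
  by (simp add: pshift_def poly_pcompose add.commute)

lemma pshift_mult: "pshift (p * q) = pshift p * pshift q"
  by (simp add: pshift_def pcompose_mult)

lemma pshift_eq_0: "pshift p = 0 \<longleftrightarrow> p = 0"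
proof
  assume "pshift p = 0"
  hence "poly p x = 0" for x using poly_pshift[of p "x - 1"] by simp
  thus "p = 0" by (simp add: poly_eq_poly_eq_iff[symmetric] fun_eq_iff)
qed (simp add: pshift_def)

lemma poly_eq_0_of_nat_roots:
  fixes p :: "rat poly"
  assumes "\<And>N. M \<le> N \<Longrightarrow> poly p (of_nat N) = 0"
  shows "p = 0"
proof (rule ccontr)
  assume "p \<noteq> 0"
  hence "finite {x. poly p x = 0}" by (rule poly_roots_finite)
  moreover have "(of_nat :: nat \<Rightarrow> rat) ` {M..} \<subseteq> {x. poly p x = 0}" using assms by auto
  moreover have "infinite ((of_nat :: nat \<Rightarrow> rat) ` {M..})"
    by (simp add: finite_image_iff infinite_Ici)
  ultimately show False using finite_subset by blast
qed

text \<open>The quotient p/q is invariant under x -> x + 1, hence constant along the integers beyond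
  the last root of q, and infinitely many values determine a polynomial.\<close>

lemma periodic_ratio_const:
  fixes p q :: "rat poly"
  assumes "q \<noteq> 0" and eq: "q * pshift p = pshift q * p"
  shows "\<exists>c. p = smult c q"
proof -
  have "finite {x. poly q x = 0}" using assms(1) by (rule poly_roots_finite)
  hence "finite ((of_nat :: nat \<Rightarrow> rat) -` {x. poly q x = 0})"
    by (rule finite_vimageI) (simp add: inj_on_def)
  then obtain M where M: "\<And>N. poly q (of_nat N) = 0 \<Longrightarrow> N < M"
    by (auto simp: finite_nat_iff_bounded)
  define c where "c = poly p (of_nat M) / poly q (of_nat M)"
  have "poly p (of_nat N) = c * poly q (of_nat N)" if "M \<le> N" for N
    using that
  proof (induction N rule: dec_induct)
    case base
    show ?case using M[of M] by (auto simp: c_def)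
  next
    case (step N)
    have nz: "poly q (of_nat N) \<noteq> 0" using M[of N] step.hyps by force
    have "poly q (of_nat N) * poly p (of_nat N + 1) = poly q (of_nat N + 1) * poly p (of_nat N)"
      using arg_cong[OF eq, of "\<lambda>r. poly r (of_nat N)"] by (simp add: poly_pshift)
    hence "poly q (of_nat N) * poly p (of_nat N + 1) = poly q (of_nat N) * (c * poly q (of_nat N + 1))"
      unfolding step.IH by (simp only: ac_simps)
    with nz show ?case by (simp only: mult_left_cancel of_nat_Suc add.commute simp_thms)
  qed
  hence "p - smult c q = 0" by (intro poly_eq_0_of_nat_roots[of M]) simp
  thus ?thesis by (intro exI[of _ c]) simp
qed

text \<open>Serves with \<open>d\<close> = 1 and \<open>d\<close> = -1: roots that propagate along
  an arithmetic progression would be infinite in number.\<close>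

lemma int_roots_bounded:
  fixes q :: "rat poly" and a d :: int
  assumes "q \<noteq> 0" "d \<noteq> 0" "poly q (of_int a) = 0"
    and step: "\<And>n::nat. poly q (of_int (a + d * int n)) = 0 \<Longrightarrow> poly q (of_int (a + d * int (Suc n))) = 0"
  shows False
proof -
  have r: "poly q (of_int (a + d * int n)) = 0" for n
    by (induction n) (use assms(3) step in auto)
  have "finite {x. poly q x = 0}" using assms(1) by (rule poly_roots_finite)
  moreover have "range (\<lambda>n. of_int (a + d * int n) :: rat) \<subseteq> {x. poly q x = 0}" using r by auto
  moreover have "infinite (range (\<lambda>n. of_int (a + d * int n) :: rat))"
    by (rule range_inj_infinite) (use assms(2) in \<open>auto simp: inj_on_def simp del: of_int_add of_int_mult\<close>)
  ultimately show False using finite_subset by blast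
qed

text \<open>An integer pole of p/q would propagate to infinitely many, since -c/x^S has a pole only at 0.\<close>

lemma no_rational_telescoping_coprime:
  fixes p q c :: "rat poly"
  assumes q: "q \<noteq> 0" and cop: "coprime p q" and deg: "degree c < S"
    and eq: "monom 1 S * (q * pshift p - pshift q * p) + q * pshift q * c = 0"
  shows "c = 0"
proof -
  have ev: "x ^ S * (poly q x * poly p (x + 1) - poly q (x + 1) * poly p x)
      + poly q x * poly q (x + 1) * poly c x = 0" for x
    using arg_cong[OF eq, of "\<lambda>r. poly r x"] by (simp add: poly_pshift poly_monom)
  have cp: "poly p x \<noteq> 0" if "poly q x = 0" for x
    using cop that coprime_poly_0[of p q x] by auto
  have nr1: "poly q (of_int a) \<noteq> 0" if "a \<ge> 1" for a
  proof
    assume "poly q (of_int a) = 0"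
    thus False
    proof (rule int_roots_bounded[where d = 1, OF q _, rotated])
      fix n :: nat assume h: "poly q (of_int (a + 1 * int n)) = 0"
      have "(of_int (a + 1 * int n) :: rat) \<noteq> 0" using that by (simp del: of_int_add)
      thus "poly q (of_int (a + 1 * int (Suc n))) = 0"
        using ev[of "of_int (a + 1 * int n)"] h cp[OF h] by (simp add: algebra_simps)
    qed simp
  qed
  have nr2: "poly q (of_int a) \<noteq> 0" if "a \<le> 0" for a
  proof
    assume "poly q (of_int a) = 0"
    thus False
    proof (rule int_roots_bounded[where d = "-1", OF q _, rotated])
      fix n :: nat assume h: "poly q (of_int (a + (-1) * int n)) = 0"
      define y :: rat where "y = of_int (a + (-1) * int (Suc n))"
      have y1: "y + 1 = of_int (a + (-1) * int n)" by (simp add: y_def)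
      have "y \<noteq> 0" unfolding y_def of_int_eq_0_iff using that by simp
      moreover have "poly q (y + 1) = 0" "poly p (y + 1) \<noteq> 0" using h cp y1 by metis+
      ultimately have "poly q y = 0" using ev[of y] by simp
      thus "poly q (of_int (a + (-1) * int (Suc n))) = 0" by (simp only: y_def)
    qed simp
  qed
  have "monom 1 S dvd q * pshift q * c"
  proof -
    have "q * pshift q * c = - (monom 1 S * (q * pshift p - pshift q * p))"
      using eq by (metis add_eq_0_iff)
    thus ?thesis by (metis dvd_minus_iff dvd_triv_left)
  qed
  \<comment> \<open>Of all excluded integer roots only 0 and 1 are used here: q(0) and q(1) are the
    values of \<open>q\<close> and \<open>pshift q\<close> at 0.\<close>
  moreover have "coprime (monom 1 S) (q * pshift q)"
  proof -
    have pr: "prime_elem [:0, 1 :: rat:]" by (rule prime_elem_linear_field_poly) simp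
    have "poly (q * pshift q) 0 \<noteq> 0"
      using nr1[of 1] nr2[of 0] by (simp add: poly_pshift)
    hence "\<not> [:0, 1:] dvd q * pshift q" using poly_eq_0_iff_dvd[of "q * pshift q" 0] by simp
    hence "coprime [:0, 1:] (q * pshift q)" using pr prime_elem_imp_coprime by blast
    thus ?thesis by (simp add: monom_altdef)
  qed
  ultimately have "monom 1 S dvd c" by (simp add: coprime_dvd_mult_right_iff)
  thus ?thesis using deg dvd_imp_degree_le[of "monom (1::rat) S" c] by (auto simp: degree_monom_eq)
qed

text \<open>The relation says that the difference of p/q is -c/x^S. The degree bound keeps out a
  polynomial part, which always telescopes. Reducing p/q by d = gcd(p, q) removes the factor d(x)
  d(x + 1).\<close>

lemma no_rational_telescoping:
  fixes p q c :: "rat poly"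
  assumes q: "q \<noteq> 0" and deg: "degree c < S"
    and eq: "monom 1 S * (q * pshift p - pshift q * p) + q * pshift q * c = 0"
  shows "c = 0"
proof -
  define d where "d = gcd p q"
  have d: "d \<noteq> 0" using q by (simp add: d_def)
  obtain p' q' where pq: "p = p' * d" "q = q' * d" "coprime p' q'"
    using gcd_coprime_exists[of p q] d unfolding d_def by blast
  have "d * pshift d * (monom 1 S * (q' * pshift p' - pshift q' * p') + q' * pshift q' * c) = 0"
    using eq by (simp add: pq pshift_mult algebra_simps)
  hence "monom 1 S * (q' * pshift p' - pshift q' * p') + q' * pshift q' * c = 0"
    using d by (simp add: pshift_eq_0)
  thus ?thesis using no_rational_telescoping_coprime[of q' p' c S] pq q deg by auto
qed

section \<open>Elimination between N and N + 1\<close>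

lemma mhs_Suc: "1 \<le> N \<Longrightarrow> mhs (k # w) (Suc N) = mhs (k # w) N + mhs w N / of_nat N ^ k"
  by (simp add: atLeastLessThanSuc)

text \<open>Passing from N to N + 1 changes \<open>mhs (k # w)\<close> by a multiple of
  \<open>mhs w\<close>, so closure under removal of the head keeps the elimination inside
  \<open>W\<close>. Because the eliminated word is a longest one, \<open>W - {u}\<close> is closed
  again.\<close>

lemma mhs_poly_independent:
  assumes "finite W" "\<And>w. w \<in> W \<Longrightarrow> \<forall>x\<in>set w. 1 \<le> x" "\<And>k w. k # w \<in> W \<Longrightarrow> w \<in> W"
    and "\<And>N. 1 \<le> N \<Longrightarrow> (\<Sum>w\<in>W. poly (P w) (of_nat N) * mhs w N) = 0"
    and "w \<in> W"
  shows "P w = 0"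
  using assms
proof (induction "card W" arbitrary: W P w rule: less_induct)
  case less
  note fin = less.prems(1) and pos = less.prems(2) and closed = less.prems(3) and rel = less.prems(4)
  have "Max (length ` W) \<in> length ` W" using fin less.prems(5) by (intro Max_in) auto
  then obtain u where u: "u \<in> W" and umax: "\<And>w. w \<in> W \<Longrightarrow> length w \<le> length u"
    using fin by (metis (no_types, lifting) Max_ge finite_imageI imageE image_eqI)
  have lt: "card (W - {u}) < card W" using fin u by (intro psubset_card_mono) auto
  have closed': "w \<in> W - {u}" if "k # w \<in> W - {u}" for k w
    using closed[of k w] umax[of "k # w"] that by auto
  have IH: "Q v = 0" if "\<And>N. 1 \<le> N \<Longrightarrow> (\<Sum>w\<in>W - {u}. poly (Q w) (of_nat N) * mhs w N) = 0"
      and "v \<in> W - {u}" for Q v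
    by (rule less.hyps[OF lt _ _ closed' that]) (use fin pos in auto)
  have "P u = 0"
  proof (rule ccontr)
    assume Pu: "P u \<noteq> 0"
    have "finite (\<Union>(set ` W))" using fin by simp
    then obtain S where S: "\<And>x. x \<in> \<Union>(set ` W) \<Longrightarrow> x \<le> S"
      by (meson finite_nat_set_iff_bounded_le)
    define T where "T v = {s. s # v \<in> W}" for v
    have T: "1 \<le> s" "s \<le> S" if "s \<in> T v" for s v
      using that pos S by (fastforce simp: T_def)+
    have finT: "finite (T v)" for v
      by (rule finite_subset[of _ "{..S}"]) (use T in auto)
    \<comment> \<open>With R(N) for the left side of the relation, \<open>C v\<close> is the
      coefficient of \<open>mhs v N\<close> in N^S (P_u(N) R(N + 1) - P_u(N + 1) R(N)). As S bounds
      all letters, N^S clears every 1/N^s.\<close>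
    define C where "C v = monom 1 S * (P u * pshift (P v) - pshift (P u) * P v)
        + P u * (\<Sum>s\<in>T v. monom 1 (S - s) * pshift (P (s # v)))" for v
    have Cu: "C u = 0"
    proof -
      have "T u = {}" using umax by (fastforce simp: T_def)
      thus ?thesis by (simp add: C_def mult.commute)
    qed
    have Crel: "(\<Sum>v\<in>W. poly (C v) (of_nat N) * mhs v N) = 0" if N: "1 \<le> N" for N
    proof -
      define x where "x = (of_nat N :: rat)"
      have x: "x \<noteq> 0" using N by (simp add: x_def)
      have "(\<Sum>v\<in>W. (\<Sum>s\<in>T v. x ^ (S - s) * poly (P (s # v)) (x + 1)) * mhs v N)
          = (\<Sum>(v, s)\<in>Sigma W T. x ^ (S - s) * poly (P (s # v)) (x + 1) * mhs v N)"
        using fin finT by (simp add: sum.Sigma sum_distrib_right)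
      also have "\<dots> = (\<Sum>w\<in>W - {[]}. x ^ (S - hd w) * poly (P w) (x + 1) * mhs (tl w) N)"
        by (rule sum.reindex_bij_witness[where i = "\<lambda>w. (tl w, hd w)" and j = "\<lambda>(v, s). s # v"])
          (auto simp: T_def closed neq_Nil_conv)
      also have "\<dots> = (\<Sum>w\<in>W - {[]}. x ^ S * (poly (P w) (x + 1) * (mhs w (Suc N) - mhs w N)))"
      proof (rule sum.cong[OF refl])
        fix w assume "w \<in> W - {[]}"
        then obtain k v where w: "w = k # v" "k \<in> T v" by (cases w) (auto simp: T_def)
        have "x ^ S = x ^ (S - k) * x ^ k" using T(2)[OF w(2)] by (simp flip: power_add)
        thus "x ^ (S - hd w) * poly (P w) (x + 1) * mhs (tl w) N
            = x ^ S * (poly (P w) (x + 1) * (mhs w (Suc N) - mhs w N))"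
          using N x unfolding w(1) mhs_Suc[OF N] by (simp add: x_def)
      qed
      also have "\<dots> = (\<Sum>w\<in>W. x ^ S * (poly (P w) (x + 1) * (mhs w (Suc N) - mhs w N)))"
        by (rule sum.mono_neutral_left) (use fin in auto)
      finally have *: "(\<Sum>v\<in>W. (\<Sum>s\<in>T v. x ^ (S - s) * poly (P (s # v)) (x + 1)) * mhs v N)
        = x ^ S * ((\<Sum>w\<in>W. poly (P w) (x + 1) * mhs w (Suc N)) - (\<Sum>w\<in>W. poly (P w) (x + 1) * mhs w N))"
        by (simp add: right_diff_distrib sum_subtractf sum_distrib_left)
      have "(\<Sum>v\<in>W. poly (C v) x * mhs v N)
        = (\<Sum>v\<in>W. x ^ S * poly (P u) x * (poly (P v) (x + 1) * mhs v N)
             - x ^ S * poly (P u) (x + 1) * (poly (P v) x * mhs v N)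
             + poly (P u) x * ((\<Sum>s\<in>T v. x ^ (S - s) * poly (P (s # v)) (x + 1)) * mhs v N))"
        by (rule sum.cong) (simp_all add: C_def poly_pshift poly_monom poly_sum algebra_simps)
      also have "\<dots> = x ^ S * poly (P u) x * (\<Sum>v\<in>W. poly (P v) (x + 1) * mhs v N)
             - x ^ S * poly (P u) (x + 1) * (\<Sum>v\<in>W. poly (P v) x * mhs v N)
             + poly (P u) x * (\<Sum>v\<in>W. (\<Sum>s\<in>T v. x ^ (S - s) * poly (P (s # v)) (x + 1)) * mhs v N)"
        by (simp only: sum.distrib sum_subtractf sum_distrib_left)
      also have "\<dots> = 0"
        unfolding * using rel[of N] rel[of "Suc N"] N by (simp add: x_def algebra_simps)
      finally show ?thesis by (simp add: x_def)
    qed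
    have C0: "C v = 0" if "v \<in> W" for v
    proof (cases "v = u")
      case False
      show ?thesis
      proof (rule IH)
        fix N :: nat assume "1 \<le> N"
        thus "(\<Sum>w\<in>W - {u}. poly (C w) (of_nat N) * mhs w N) = 0"
          using Crel[of N] by (simp add: sum.remove[OF fin u] Cu)
      qed (use False that in auto)
    qed (simp add: Cu)
    show False
    proof (cases u)
      case Nil
      hence "W = {[]}" using umax u by auto
      hence "poly (P u) (of_nat N) = 0" if "1 \<le> N" for N using rel[OF that] Nil by simp
      thus False using poly_eq_0_of_nat_roots[of 1 "P u"] Pu by blast
    next
      case (Cons s0 v)
      have v: "v \<in> W" and s0: "s0 \<in> T v" using u closed Cons by (auto simp: T_def)
      \<comment> \<open>A word \<open>s # v\<close> is as long as \<open>u\<close>, so no word of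
        \<open>W\<close> extends it, and \<open>C (s # v) = 0\<close> only says that P(s # v)/P(u)
        is invariant under the shift.\<close>
      have "\<exists>c. P (s # v) = smult c (P u)" if "s \<in> T v" for s
      proof (rule periodic_ratio_const[OF Pu])
        have "T (s # v) = {}" using umax Cons by (fastforce simp: T_def)
        hence "monom 1 S * (P u * pshift (P (s # v)) - pshift (P u) * P (s # v)) = 0"
          using C0[of "s # v"] that by (simp add: C_def T_def)
        thus "P u * pshift (P (s # v)) = pshift (P u) * P (s # v)" by simp
      qed
      then obtain c where c: "\<And>s. s \<in> T v \<Longrightarrow> P (s # v) = smult (c s) (P u)" by metis
      \<comment> \<open>Divided by N^S P_u(N) P_u(N + 1), the equation \<open>C v = 0\<close> says
        that the difference of P_v/P_u is -D/N^S, where D/N^S is the sum of the c_s N^(-s).\<close>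
      define D where "D = (\<Sum>s\<in>T v. monom (c s) (S - s))"
      have "(\<Sum>s\<in>T v. monom 1 (S - s) * pshift (P (s # v))) = pshift (P u) * D"
        unfolding D_def sum_distrib_left
      proof (rule sum.cong[OF refl])
        fix s assume "s \<in> T v"
        moreover have "monom (c s) (S - s) = smult (c s) (monom 1 (S - s))" by (simp add: smult_monom)
        ultimately show "monom 1 (S - s) * pshift (P (s # v)) = pshift (P u) * monom (c s) (S - s)"
          by (simp add: c pshift_def pcompose_smult mult.commute)
      qed
      hence "monom 1 S * (P u * pshift (P v) - pshift (P u) * P v) + P u * pshift (P u) * D = 0"
        using C0[OF v] by (simp add: C_def mult.assoc)
      moreover have "degree D < S"
      proof -
        have "S \<ge> 1" using T[OF s0] by simp
        moreover have "degree D \<le> S - 1" unfolding D_def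
        proof (rule degree_sum_le)
          fix s assume "s \<in> T v"
          thus "degree (monom (c s) (S - s)) \<le> S - 1"
            using T(1)[of s v] degree_monom_le[of "c s" "S - s"] by linarith
        qed (rule finT)
        ultimately show ?thesis by linarith
      qed
      ultimately have "D = 0" using no_rational_telescoping[OF Pu] by blast
      \<comment> \<open>Letters bounded by S have distinct exponents S - s, so this coefficient
        isolates \<open>c s0\<close>; it cannot vanish, since \<open>s0 # v\<close> is
        \<open>u\<close> itself.\<close>
      moreover have "coeff D (S - s0) = (\<Sum>s\<in>T v. if s = s0 then c s0 else 0)"
        unfolding D_def coeff_sum
      proof (rule sum.cong[OF refl])
        fix s assume "s \<in> T v"
        hence "S - s = S - s0 \<longleftrightarrow> s = s0" using T(2)[of s v] T(2)[OF s0] by linarith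
        thus "coeff (monom (c s) (S - s)) (S - s0) = (if s = s0 then c s0 else 0)" by simp
      qed
      ultimately have "c s0 = 0" using s0 finT[of v] by simp
      thus False using c[OF s0] Pu Cons by simp
    qed
  qed
  show ?case
  proof (cases "w = u")
    case False
    show ?thesis
    proof (rule IH)
      fix N :: nat assume "1 \<le> N"
      thus "(\<Sum>w\<in>W - {u}. poly (P w) (of_nat N) * mhs w N) = 0"
        using rel[of N] \<open>P u = 0\<close> by (simp add: sum.remove[OF fin u])
    qed (use False less.prems(5) in auto)
  qed (simp add: \<open>P u = 0\<close>)
qed

section \<open>The shift from N to N + 1\<close>

definition qsum :: "nat \<Rightarrow> (nat \<Rightarrow> rat) \<Rightarrow> nat \<Rightarrow> rat" where
  "qsum k h n = (\<Sum>m\<in>{1..<n}. h m / of_nat m ^ k)"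

text \<open>The strict half goes with 1/m, the weak half with 1/(N - m). For n = N the weak term m =
  N has denominator 0 and therefore value 0.\<close>

definition letter1 :: "nat \<Rightarrow> (nat \<Rightarrow> rat) \<Rightarrow> nat \<Rightarrow> rat" where
  "letter1 N h n = (\<Sum>m\<in>{1..<n}. h m / of_nat m) + (\<Sum>m\<in>{1..n}. h m / of_nat (N - m))"

text \<open>The recursion absorbs the sum over the subsets A: a letter 1 collects both choices for
  its position. The argument n is the running upper bound of the outermost variable.\<close>

fun dsum :: "nat \<Rightarrow> nat list \<Rightarrow> nat \<Rightarrow> rat" where
  "dsum N [] n = 1"
| "dsum N (k # w) n = (if k = 1 then letter1 N (dsum N w) n else qsum k (dsum N w) n)"

text \<open>dsum_open differs from dsum only in that the outermost letter 1 loses its diagonal term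
  dsum N v n / (N - n); unlike dsum it is therefore meaningful up to n = N.\<close>

fun dsum_open :: "nat \<Rightarrow> nat list \<Rightarrow> nat \<Rightarrow> rat" where
  "dsum_open N [] n = 1"
| "dsum_open N (k # w) n = (if k = 1 then \<Sum>m\<in>{1..<n}. dsum N w m * (1 / of_nat m + 1 / of_nat (N - m))
                    else qsum k (dsum N w) n)"

lemma dsum_open_ge2: "k \<noteq> 1 \<Longrightarrow> dsum_open N (k # w) n = qsum k (dsum N w) n"
  by simp

lemma dsum_open_letter1:
  "dsum_open N (Suc 0 # w) n = (\<Sum>m\<in>{1..<n}. dsum N w m * (1 / of_nat m + 1 / of_nat (N - m)))"
  by simp

lemma dsum_open_Nil: "dsum_open N [] n = 1"
  by simp

definition dsum_unit_head :: "nat \<Rightarrow> nat list \<Rightarrow> nat \<Rightarrow> rat" where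
  "dsum_unit_head N w n = (case w of k # v \<Rightarrow> if k = 1 then dsum N v n else 0 | [] \<Rightarrow> 0)"

lemma dsum_unit_head_simps [simp]:
  "dsum_unit_head N [] n = 0" "dsum_unit_head N (Suc 0 # v) n = dsum N v n" "k \<noteq> 1 \<Longrightarrow> dsum_unit_head N (k # v) n = 0"
  by (auto simp: dsum_unit_head_def)

lemma dsum_open_eq_dsum: "1 \<le> n \<Longrightarrow> dsum_open N w n = dsum N w n - dsum_unit_head N w n / of_nat (N - n)"
proof (cases w)
  case (Cons k v)
  assume "1 \<le> n"
  hence "{1..n} = insert n {1..<n}" by auto
  thus ?thesis using Cons
    by (auto simp: letter1_def sum.distrib distrib_left)
qed simp

lemma qsum_add: "qsum k (\<lambda>m. f m + g m) n = qsum k f n + qsum k g n"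
  by (simp add: qsum_def add_divide_distrib sum.distrib)

lemma qsum_cmult: "qsum k (\<lambda>m. c * f m) n = c * qsum k f n"
  by (simp add: qsum_def sum_distrib_left)

lemma qsum_cong: "(\<And>m. 1 \<le> m \<Longrightarrow> m < n \<Longrightarrow> f m = g m) \<Longrightarrow> qsum k f n = qsum k g n"
  by (simp add: qsum_def)

lemma letter1_add: "letter1 N (\<lambda>m. f m + g m) n = letter1 N f n + letter1 N g n"
  by (simp add: letter1_def add_divide_distrib sum.distrib)

lemma letter1_cmult: "letter1 N (\<lambda>m. c * f m) n = c * letter1 N f n"
  by (simp add: letter1_def sum_distrib_left distrib_left)

lemma letter1_cong: "(\<And>m. 1 \<le> m \<Longrightarrow> m \<le> n \<Longrightarrow> f m = g m) \<Longrightarrow> letter1 N f n = letter1 N g n"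
  by (simp add: letter1_def)

declare dsum_open.simps [simp del]
declare dsum_open_ge2 [simp] dsum_open_Nil [simp]

text \<open>For a head other than 1 this is the summand of the outermost letter, the function to
  which U is applied; for a head 1 it is the 1/m half of the summand.\<close>

definition dsum_source :: "nat \<Rightarrow> nat list \<Rightarrow> nat \<Rightarrow> rat" where
  "dsum_source N w n = (case w of k # v \<Rightarrow> dsum N v n / of_nat n ^ k | [] \<Rightarrow> 0)"

text \<open>The step leads to the full \<open>dsum\<close>: for a head 1 the new index m contributes
  1/(N - m), which restores the missing diagonal term, and 1/m, which is the source.\<close>

lemma dsum_open_Suc:
  assumes "1 \<le> m"
  shows "dsum_open N w (Suc m) = dsum N w m + dsum_source N w m"
proof (cases w)
  case (Cons k v)
  have *: "{Suc 0..<Suc m} = insert m {Suc 0..<m}" "{Suc 0..m} = insert m {Suc 0..<m}" using assms by auto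
  show ?thesis
  proof (cases "k = 1")
    case True
    thus ?thesis using Cons by (simp add: dsum_open_letter1 letter1_def dsum_source_def sum.distrib distrib_left *)
  next
    case False
    thus ?thesis using Cons by (simp add: dsum_source_def qsum_def *)
  qed
qed (simp add: dsum_source_def)

lemma dsum_open_1: "dsum_open N w 1 = (if w = [] then 1 else 0)"
  by (cases w) (auto simp: qsum_def dsum_open.simps)

text \<open>Coefficient form of U^(N+1) A = A U. After the index shift, a head 1 causes exact
  cancellation: the diagonal term lost at 1/m and the source gained at 1/(N - m) carry the same
  factor 1/(m (N - m)). The other terms arise where the block of ones ends: the x-coefficient of A
  on the source, or, for the empty word, the value 1/N at m = 1.\<close>

lemma letter1_open:
  assumes "1 \<le> n" "n \<le> N"
  shows "letter1 (Suc N) (dsum_open N w) n = dsum_open N (1 # w) n + (if w = [] then 1 / of_nat N else 0)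
     + (\<Sum>m\<in>{1..<n}. (if w \<noteq> [] \<and> hd w \<noteq> 1 then dsum_source N w m else 0) / of_nat (N - m))"
proof -
  have "(\<Sum>m\<in>{1..n}. dsum_open N w m / of_nat (Suc N - m)) = dsum_open N w 1 / of_nat N + (\<Sum>m\<in>{2..n}. dsum_open N w m / of_nat (Suc N - m))"
    using assms by (simp add: sum.atLeast_Suc_atMost numeral_2_eq_2)
  also have "(\<Sum>m\<in>{2..n}. dsum_open N w m / of_nat (Suc N - m)) = (\<Sum>m\<in>{1..<n}. dsum_open N w (Suc m) / of_nat (N - m))"
    by (rule sum.reindex_bij_witness[where i = Suc and j = "\<lambda>m. m - 1"]) auto
  also have "\<dots> = (\<Sum>m\<in>{1..<n}. (dsum N w m + dsum_source N w m) / of_nat (N - m))"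
    by (rule sum.cong) (simp_all add: dsum_open_Suc)
  finally have "letter1 (Suc N) (dsum_open N w) n = dsum_open N w 1 / of_nat N +
      (\<Sum>m\<in>{1..<n}. dsum_open N w m / of_nat m + (dsum N w m + dsum_source N w m) / of_nat (N - m))"
    by (simp add: letter1_def sum.distrib)
  also have "(\<Sum>m\<in>{1..<n}. dsum_open N w m / of_nat m + (dsum N w m + dsum_source N w m) / of_nat (N - m))
     = (\<Sum>m\<in>{1..<n}. dsum N w m * (1 / of_nat m + 1 / of_nat (N - m)) +
         (if w \<noteq> [] \<and> hd w \<noteq> 1 then dsum_source N w m else 0) / of_nat (N - m))"
  proof (rule sum.cong[OF refl])
    fix m assume m: "m \<in> {1..<n}"
    show "dsum_open N w m / of_nat m + (dsum N w m + dsum_source N w m) / of_nat (N - m) =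
      dsum N w m * (1 / of_nat m + 1 / of_nat (N - m)) +
         (if w \<noteq> [] \<and> hd w \<noteq> 1 then dsum_source N w m else 0) / of_nat (N - m)"
      using m by (cases w; cases "hd w = 1") (auto simp del: dsum.simps(2) simp: dsum_open_eq_dsum dsum_source_def distrib_left add_divide_distrib diff_divide_distrib)
  qed
  finally show ?thesis by (simp add: dsum_open_1[unfolded One_nat_def] dsum_open_letter1 sum.distrib)
qed

section \<open>Coefficients of the operator identity\<close>

definition shifted_block :: "nat \<Rightarrow> nat \<Rightarrow> nat \<Rightarrow> nat list \<Rightarrow> nat \<Rightarrow> rat" where
  "shifted_block N a b w = (letter1 (Suc N) ^^ a) (qsum (b + 2) (dsum_open N w))"

definition ones :: "nat \<Rightarrow> nat list \<Rightarrow> nat list" where "ones a w = replicate a 1 @ w"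

lemma ones_simps [simp]: "ones 0 w = w" "ones (Suc a) w = 1 # ones a w"
  by (auto simp: ones_def)

lemma shifted_block_simps:
  "shifted_block N 0 b w = qsum (b + 2) (dsum_open N w)"
  "shifted_block N (Suc a) b w = letter1 (Suc N) (shifted_block N a b w)"
  by (auto simp: shifted_block_def)

text \<open>Multiplication by x lowers the number of leading ones of \<open>w\<close> by one, so a
  word without a leading 1 gets coefficient 0; \<open>u\<close> is what stands outside of
  \<open>w\<close>.\<close>

definition open_tail :: "nat \<Rightarrow> nat list \<Rightarrow> nat list \<Rightarrow> nat \<Rightarrow> rat" where
  "open_tail N u w n = (case w of k # v \<Rightarrow> if k = 1 then dsum_open N (u @ v) n else 0 | [] \<Rightarrow> 0)"

lemma open_tail_simps [simp]:
  "open_tail N u [] n = 0" "open_tail N u (Suc 0 # v) n = dsum_open N (u @ v) n" "k \<noteq> 1 \<Longrightarrow> open_tail N u (k # v) n = 0"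
  by (auto simp: open_tail_def)

text \<open>With w = 1^c w0, the two sides are the coefficients of x'^a y^b x^c in the identity for
  N(N-x'-y) U_x'^(N+1) M_y A_x U_x.\<close>

definition shift_lhs where "shift_lhs N a b w n = of_nat N ^ 2 * shifted_block N a b w n
   - of_nat N * (if a > 0 then shifted_block N (a - 1) b w n else 0)
   - of_nat N * (if b > 0 then shifted_block N a (b - 1) w n else 0)"

definition shift_rhs where "shift_rhs N a b w n = of_nat N ^ 2 * dsum_open N (ones a ((b + 2) # w)) n
   - of_nat N * open_tail N (ones a [b + 2]) w n
   - of_nat N * (if b > 0 then dsum_open N (ones a ((b + 1) # w)) n else 0)
   + (if b = 0 \<and> (w = [] \<or> hd w \<noteq> 1) then dsum_open N (ones a w) n else 0)
   - (if a = 0 \<and> b = 0 then dsum_open N w n else 0)"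

text \<open>With a = 0 no summation at level N + 1 occurs, and the claim is N/(m^k (N - m)) = 1/m^k
  + 1/(m^(k-1) (N - m)) under the sum over m. For b = 0 the second fraction, times N, splits once
  more into 1/m + 1/(N - m) and produces \<open>dsum_open N w\<close>.\<close>

lemma shift_identity_0:
  assumes "1 \<le> n" "n \<le> N"
  shows "shift_lhs N 0 b w n = shift_rhs N 0 b w n"
proof (cases "w \<noteq> [] \<and> hd w = 1")
  case False
  hence "dsum_unit_head N w m = 0" "open_tail N u w m = 0" for u m by (cases w; auto)+
  hence "qsum k (dsum_open N w) n = qsum k (dsum N w) n" for k
    by (intro qsum_cong) (simp add: dsum_open_eq_dsum)
  thus ?thesis using False \<open>\<And>u m. open_tail N u w m = 0\<close> by (auto simp: shift_lhs_def shift_rhs_def shifted_block_simps)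
next
  case True
  then obtain v where w: "w = 1 # v" by (cases w) auto
  have eq: "qsum k (dsum_open N w) n = qsum k (dsum N w) n - (\<Sum>m\<in>{1..<n}. dsum N v m / (of_nat m ^ k * of_nat (N - m)))" for k
    unfolding qsum_def sum_subtractf[symmetric]
    by (rule sum.cong) (auto simp: dsum_open_eq_dsum w diff_divide_distrib mult.commute simp del: dsum.simps)
  show ?thesis
  proof (cases "b = 0")
    case b: True
    have "of_nat N ^ 2 * (\<Sum>m\<in>{1..<n}. dsum N v m / (of_nat m ^ 2 * of_nat (N - m)))
       = of_nat N * qsum 2 (dsum N v) n + (\<Sum>m\<in>{1..<n}. dsum N v m * (1 / of_nat m + 1 / of_nat (N - m)))"
      unfolding qsum_def sum_distrib_left sum.distrib[symmetric]
    proof (rule sum.cong[OF refl])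
      fix m assume "m \<in> {1..<n}"
      hence "1 \<le> m" "m < N" using assms by auto
      thus "of_nat N ^ 2 * (dsum N v m / (of_nat m ^ 2 * of_nat (N - m))) =
        of_nat N * (dsum N v m / of_nat m ^ 2) + dsum N v m * (1 / of_nat m + 1 / of_nat (N - m))"
        by (simp add: field_simps of_nat_diff power2_eq_square)
    qed
    thus ?thesis by (simp add: b shift_lhs_def shift_rhs_def shifted_block_simps eq right_diff_distrib) (simp add: w dsum_open_letter1 numeral_2_eq_2)
  next
    case b: False
    have "of_nat N ^ 2 * (\<Sum>m\<in>{1..<n}. dsum N v m / (of_nat m ^ (b+2) * of_nat (N - m)))
       = of_nat N * qsum (b+2) (dsum N v) n + of_nat N * (\<Sum>m\<in>{1..<n}. dsum N v m / (of_nat m ^ (b+1) * of_nat (N - m)))"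
      unfolding qsum_def sum_distrib_left sum.distrib[symmetric]
    proof (rule sum.cong[OF refl])
      fix m assume "m \<in> {1..<n}"
      hence "1 \<le> m" "m < N" using assms by auto
      thus "of_nat N ^ 2 * (dsum N v m / (of_nat m ^ (b+2) * of_nat (N - m))) =
        of_nat N * (dsum N v m / of_nat m ^ (b+2)) + of_nat N * (dsum N v m / (of_nat m ^ (b+1) * of_nat (N - m)))"
        by (simp add: field_simps of_nat_diff power2_eq_square)
    qed
    moreover have "b - 1 + 2 = b + 1" using b by simp
    ultimately show ?thesis using b
      by (simp add: shift_lhs_def shift_rhs_def shifted_block_simps eq right_diff_distrib) (simp add: w)
  qed
qed

lemma letter1_diff: "letter1 N (\<lambda>m. f m - g m) n = letter1 N f n - letter1 N g n"
  by (simp add: letter1_def diff_divide_distrib sum_subtractf)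

lemma letter1_zero [simp]: "letter1 N (\<lambda>m. 0) n = 0"
  by (simp add: letter1_def)

lemma letter1_if: "letter1 N (\<lambda>m. if P then f m else 0) n = (if P then letter1 N f n else 0)"
  by simp

lemma hd_ones: "0 < a \<Longrightarrow> ones a w \<noteq> [] \<and> hd (ones a w) = 1"
  by (cases a) auto

lemma letter1_open_ones:
  "0 < a \<Longrightarrow> 1 \<le> n \<Longrightarrow> n \<le> N \<Longrightarrow> letter1 (Suc N) (dsum_open N (ones a w)) n = dsum_open N (ones (Suc a) w) n"
  using hd_ones[of a w] by (simp add: letter1_open)

lemma ones_append: "ones a u @ v = ones a (u @ v)"
  by (simp add: ones_def)

lemma letter1_open_tail_ones:
  assumes "0 < a" "1 \<le> n" "n \<le> N"
  shows "letter1 (Suc N) (open_tail N (ones a u) w) n = open_tail N (ones (Suc a) u) w n"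
proof (cases "w \<noteq> [] \<and> hd w = 1")
  case True
  then obtain v where "w = 1 # v" by (cases w) auto
  hence "open_tail N (ones c u) w = dsum_open N (ones c (u @ v))" for c by (auto simp: open_tail_def ones_append)
  thus ?thesis using letter1_open_ones[OF assms] by (simp del: ones_simps)
next
  case False
  hence "open_tail N x w = (\<lambda>_. 0)" for x by (cases w) auto
  thus ?thesis by simp
qed

text \<open>The letter of level N + 1 raises a by one in every term, but at a = 0 the term for a - 1
  is absent; its image has to be supplied at a = 1.\<close>

lemma shift_lhs_Suc: "shift_lhs N (Suc a) b w n = letter1 (Suc N) (shift_lhs N a b w) n
    - (if a = 0 then of_nat N * shifted_block N 0 b w n else 0)"
proof -
  have "shift_lhs N a b w = (\<lambda>m. of_nat N ^ 2 * shifted_block N a b w m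
   - of_nat N * (if a > 0 then shifted_block N (a - 1) b w m else 0)
   - of_nat N * (if b > 0 then shifted_block N a (b - 1) w m else 0))" by (auto simp: shift_lhs_def)
  thus ?thesis
    by (cases a; cases b) (simp_all add: letter1_diff letter1_cmult shift_lhs_def shifted_block_simps(2))
qed

text \<open>For a > 0 every word on the right that is present begins with 1, so
  \<open>letter1_open\<close> acts without boundary terms.\<close>

lemma shift_rhs_Suc:
  assumes "0 < a" "1 \<le> n" "n \<le> N"
  shows "shift_rhs N (Suc a) b w n = letter1 (Suc N) (shift_rhs N a b w) n"
proof -
  have "shift_rhs N a b w = (\<lambda>m. of_nat N ^ 2 * dsum_open N (ones a ((b + 2) # w)) m
   - of_nat N * open_tail N (ones a [b + 2]) w m
   - of_nat N * (if b > 0 then dsum_open N (ones a ((b + 1) # w)) m else 0)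
   + (if b = 0 \<and> (w = [] \<or> hd w \<noteq> 1) then dsum_open N (ones a w) m else 0))"
    using assms(1) by (auto simp: shift_rhs_def)
  thus ?thesis
    by (simp only: letter1_diff letter1_add letter1_cmult letter1_if
         letter1_open_ones[OF assms] letter1_open_tail_ones[OF assms]) (simp add: shift_rhs_def)
qed

text \<open>Read with x = m, y = N - m, f = \<open>dsum N w m\<close> and h =
  \<open>dsum_unit_head N w m\<close>, so that f - h/y is \<open>dsum_open N w m\<close>.\<close>

lemma shift_identity_1_summand:
  fixes x y f h :: rat
  assumes "x \<noteq> 0" "y \<noteq> 0"
  shows "(x + y) ^ 2 * (f / (x ^ (b + 2) * y)) - (x + y) * (h / (x ^ (b + 2) * y))
    - (x + y) * (if b > 0 then f / (x ^ (b + 1) * y) else 0) - (x + y) * ((f - h / y) / x ^ (b + 2))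
    = (if b = 0 then f * (1 / x + 1 / y) else 0)"
proof -
  define z where "z = x ^ b"
  have z: "z \<noteq> 0" "x ^ (b + 2) = z * x * x" "x ^ (b + 1) = z * x" "b = 0 \<Longrightarrow> z = 1"
    using assms by (auto simp: z_def)
  show ?thesis unfolding z(2,3) using assms z(1,4)
    by (cases "b = 0") (simp_all add: divide_simps, simp_all add: algebra_simps power2_eq_square)
qed

text \<open>This case stands apart because at a = 0 words begin with a letter other than 1 and
  \<open>letter1_open\<close> leaves sums over sources. Together with the missing term -N
  \<open>shifted_block N 0 b w\<close> they add up to the new term
  \<open>dsum_open N (1 # w)\<close> at b = 0, and to 0 otherwise.\<close>

lemma shift_identity_1:
  assumes n: "1 \<le> n" "n \<le> N"
  shows "shift_lhs N 1 b w n = shift_rhs N 1 b w n"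
proof -
  define Q where "Q k v = (\<Sum>m\<in>{1..<n}. dsum N v m / (of_nat m ^ k * of_nat (N - m)))" for k v
  define QH where "QH = (\<Sum>m\<in>{1..<n}. dsum_unit_head N w m / (of_nat m ^ (b + 2) * of_nat (N - m)))"
  have EQ: "letter1 (Suc N) (dsum_open N (k # v)) n = dsum_open N (1 # k # v) n + Q k v" if "k \<noteq> 1" for k v
    using that by (simp add: letter1_open[OF n] dsum_source_def Q_def)
  have D: "letter1 (Suc N) (open_tail N [b + 2] w) n = open_tail N [1, b + 2] w n + QH"
  proof (cases "w \<noteq> [] \<and> hd w = 1")
    case True
    then obtain v where "w = 1 # v" by (cases w) auto
    moreover from this have "open_tail N x w = dsum_open N (x @ v)" for x by (auto simp: open_tail_def)
    ultimately show ?thesis using EQ[of "b + 2" v] by (simp add: QH_def Q_def)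
  next
    case False
    hence "open_tail N x w = (\<lambda>_. 0)" "dsum_unit_head N w m = 0" for x m by (cases w; auto)+
    thus ?thesis by (simp add: QH_def)
  qed
  have W: "letter1 (Suc N) (dsum_open N w) n = dsum_open N (1 # w) n" if "w \<noteq> [] \<and> hd w = 1"
    using that by (simp add: letter1_open[OF n])
  have "shift_lhs N 1 b w n = letter1 (Suc N) (shift_rhs N 0 b w) n - of_nat N * shifted_block N 0 b w n"
  proof -
    have "letter1 (Suc N) (shift_lhs N 0 b w) n = letter1 (Suc N) (shift_rhs N 0 b w) n"
      by (rule letter1_cong) (use n in \<open>auto intro: shift_identity_0\<close>)
    thus ?thesis using shift_lhs_Suc[of N 0 b w n] by simp
  qed
  also have "shift_rhs N 0 b w = (\<lambda>m. of_nat N ^ 2 * dsum_open N ((b + 2) # w) m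
   - of_nat N * open_tail N [b + 2] w m
   - of_nat N * (if b > 0 then dsum_open N ((b + 1) # w) m else 0)
   - (if b = 0 \<and> (w \<noteq> [] \<and> hd w = 1) then dsum_open N w m else 0))"
    by (auto simp: shift_rhs_def)
  also have "letter1 (Suc N) \<dots> n = of_nat N ^ 2 * (dsum_open N (1 # (b + 2) # w) n + Q (b + 2) w)
   - of_nat N * (open_tail N [1, b + 2] w n + QH)
   - of_nat N * (if b > 0 then dsum_open N (1 # (b + 1) # w) n + Q (b + 1) w else 0)
   - (if b = 0 \<and> (w \<noteq> [] \<and> hd w = 1) then dsum_open N (1 # w) n else 0)"
    unfolding letter1_diff letter1_add letter1_cmult letter1_if using D W
    by (auto simp: EQ simp del: dsum_open_ge2)
  finally have *: "shift_lhs N 1 b w n = \<dots> - of_nat N * shifted_block N 0 b w n" .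
  have "of_nat N ^ 2 * Q (b + 2) w - of_nat N * QH - of_nat N * (if b > 0 then Q (b + 1) w else 0)
     - of_nat N * shifted_block N 0 b w n = (if b = 0 then dsum_open N (1 # w) n else 0)"
  proof -
    have "of_nat N ^ 2 * Q (b + 2) w - of_nat N * QH - of_nat N * (if b > 0 then Q (b + 1) w else 0)
     - of_nat N * shifted_block N 0 b w n = (\<Sum>m\<in>{1..<n}. 
        of_nat N ^ 2 * (dsum N w m / (of_nat m ^ (b + 2) * of_nat (N - m)))
        - of_nat N * (dsum_unit_head N w m / (of_nat m ^ (b + 2) * of_nat (N - m)))
        - of_nat N * (if b > 0 then dsum N w m / (of_nat m ^ (b + 1) * of_nat (N - m)) else 0)
        - of_nat N * (dsum_open N w m / of_nat m ^ (b + 2)))"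
      by (simp add: Q_def QH_def shifted_block_simps qsum_def sum_distrib_left sum_subtractf)
    also have "\<dots> = (\<Sum>m\<in>{1..<n}. if b = 0 then dsum N w m * (1 / of_nat m + 1 / of_nat (N - m)) else 0)"
    proof (rule sum.cong[OF refl])
      fix m assume "m \<in> {1..<n}"
      hence m: "1 \<le> m" "m < N" using n by auto
      have N: "(of_nat N :: rat) = of_nat m + of_nat (N - m)" using m by (simp add: of_nat_diff)
      have nz: "(of_nat m :: rat) \<noteq> 0" "(of_nat (N - m) :: rat) \<noteq> 0" using m by auto
      show "of_nat N ^ 2 * (dsum N w m / (of_nat m ^ (b + 2) * of_nat (N - m)))
        - of_nat N * (dsum_unit_head N w m / (of_nat m ^ (b + 2) * of_nat (N - m)))
        - of_nat N * (if b > 0 then dsum N w m / (of_nat m ^ (b + 1) * of_nat (N - m)) else 0)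
        - of_nat N * (dsum_open N w m / of_nat m ^ (b + 2))
        = (if b = 0 then dsum N w m * (1 / of_nat m + 1 / of_nat (N - m)) else 0)"
        unfolding dsum_open_eq_dsum[OF m(1)] N by (rule shift_identity_1_summand[OF nz])
    qed
    also have "\<dots> = (if b = 0 then dsum_open N (1 # w) n else 0)"
      by (simp add: dsum_open_letter1)
    finally show ?thesis .
  qed
  thus ?thesis unfolding * shift_rhs_def
    by (auto simp: algebra_simps simp del: dsum_open_ge2)
qed

lemma shift_identity:
  assumes n: "1 \<le> n" "n \<le> N"
  shows "shift_lhs N a b w n = shift_rhs N a b w n"
  using n
proof (induction a arbitrary: n)
  case 0
  show ?case using shift_identity_0 0 .
next
  case (Suc a)
  show ?case
  proof (cases "a = 0")
    case True
    thus ?thesis using shift_identity_1[OF Suc.prems] by simp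
  next
    case False
    have "letter1 (Suc N) (shift_lhs N a b w) n = letter1 (Suc N) (shift_rhs N a b w) n"
      by (rule letter1_cong) (use Suc in auto)
    thus ?thesis using False shift_rhs_Suc[OF _ Suc.prems] shift_lhs_Suc[of N a b w n] by simp
  qed
qed

section \<open>Expansion in 1/N modulo order 2\<close>

text \<open>Combinations of order at least d in 1/N and of weight k, compared only where 1 \<le> n \<le> N.\<close>

inductive dspan :: "nat \<Rightarrow> nat \<Rightarrow> (nat \<Rightarrow> nat \<Rightarrow> rat) \<Rightarrow> bool" for d k where
  dspan_zero: "dspan d k (\<lambda>N n. 0)"
| dspan_add: "dspan d k f \<Longrightarrow> dspan d k g \<Longrightarrow> dspan d k (\<lambda>N n. f N n + g N n)"
| dspan_base: "d \<le> s \<Longrightarrow> s + sum_list v = k \<Longrightarrow> \<forall>x\<in>set v. 1 \<le> x \<Longrightarrow> dspan d k (\<lambda>N n. c * (dsum_open N v n / of_nat N ^ s))"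
| dspan_cong: "dspan d k f \<Longrightarrow> (\<And>N n. 1 \<le> n \<Longrightarrow> n \<le> N \<Longrightarrow> f N n = g N n) \<Longrightarrow> dspan d k g"

lemma dspan_cmult_div:
  assumes "dspan d k f"
  shows "dspan (d + j) (k + j) (\<lambda>N n. c * (f N n / of_nat N ^ j))"
  using assms
proof induction
  case dspan_zero
  show ?case using dspan.dspan_zero by simp
next
  case (dspan_add f g)
  show ?case by (rule dspan_cong[OF dspan.dspan_add[OF dspan_add.IH]]) (simp add: add_divide_distrib distrib_left)
next
  case (dspan_base s v c')
  have "dspan (d + j) (k + j) (\<lambda>N n. (c * c') * (dsum_open N v n / of_nat N ^ (s + j)))"
    by (rule dspan.dspan_base) (use dspan_base in auto)
  thus ?case by (simp add: power_add mult.assoc)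
next
  case (dspan_cong f g)
  show ?case by (rule dspan.dspan_cong[OF dspan_cong.IH]) (simp add: dspan_cong)
qed

lemma dspan_mono: "dspan d k f \<Longrightarrow> e \<le> d \<Longrightarrow> dspan e k f"
proof (induction rule: dspan.induct)
  case (dspan_base s v c)
  thus ?case by (intro dspan.dspan_base) auto
qed (auto intro: dspan.intros)

lemma dspan_div: "dspan d k f \<Longrightarrow> dspan (Suc d) (Suc k) (\<lambda>N n. f N n / of_nat N)"
  using dspan_cmult_div[of d k f 1 1] by simp

lemma dspan_uminus: "dspan d k f \<Longrightarrow> dspan d k (\<lambda>N n. - f N n)"
  using dspan_cmult_div[of d k f 0 "-1"] by simp

lemma dspan_diff: "dspan d k f \<Longrightarrow> dspan d k g \<Longrightarrow> dspan d k (\<lambda>N n. f N n - g N n)"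
  using dspan_add[OF _ dspan_uminus, of d k f g] by simp

lemma dspan_open: "\<forall>x\<in>set v. 1 \<le> x \<Longrightarrow> s + sum_list v = k \<Longrightarrow> dspan s k (\<lambda>N n. dsum_open N v n / of_nat N ^ s)"
  using dspan_base[of s s v k 1] by simp

lemma dspan_open_0: "\<forall>x\<in>set v. 1 \<le> x \<Longrightarrow> sum_list v = k \<Longrightarrow> dspan 0 k (\<lambda>N n. dsum_open N v n)"
  using dspan_open[of v 0 k] by simp

lemma dspan_open_1: "\<forall>x\<in>set v. 1 \<le> x \<Longrightarrow> 1 + sum_list v = k \<Longrightarrow> dspan 1 k (\<lambda>N n. dsum_open N v n / of_nat N)"
  using dspan_open[of v 1 k] by simp

lemma dspan_if: "(P \<Longrightarrow> dspan d k f) \<Longrightarrow> dspan d k (\<lambda>N n. if P then f N n else 0)"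
  by (cases P) (simp_all add: dspan_zero)

lemma ones_set: "set (ones a w) = (if a = 0 then {} else {1}) \<union> set w"
  and ones_sum: "sum_list (ones a w) = a + sum_list w"
  by (auto simp: ones_def sum_list_replicate)

lemma dspan_open_tail:
  assumes "\<forall>x\<in>set u. 1 \<le> x" "\<forall>x\<in>set w. 1 \<le> x" "sum_list u + sum_list w = k"
  shows "dspan 1 k (\<lambda>N n. open_tail N u w n / of_nat N)"
proof (cases "w \<noteq> [] \<and> hd w = 1")
  case True
  then obtain v where w: "w = 1 # v" by (cases w) auto
  thus ?thesis using dspan_open_1[of "u @ v" k] assms by (simp add: ball_Un)
next
  case False
  hence "open_tail N u w n = 0" for N n by (cases w) auto
  thus ?thesis by (simp add: dspan_zero)
qed

text \<open>The second-order expansion is a hypothesis here so that this weakening can be used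
  inside the induction that proves it.\<close>

lemma block_shift_mod_linear:
  assumes mod_square: "dspan 2 (a + b + 2 + sum_list w) (\<lambda>N n. shifted_block N a b w n - dsum_open N (ones a ((b + 2) # w)) n
     - (if a > 0 then dsum_open N (ones (a - 1) ((b + 2) # w)) n / of_nat N else 0)
     + open_tail N (ones a [b + 2]) w n / of_nat N)"
   and w: "\<forall>x\<in>set w. 1 \<le> x"
  shows "dspan 1 (a + b + 2 + sum_list w) (\<lambda>N n. shifted_block N a b w n - dsum_open N (ones a ((b + 2) # w)) n)"
proof -
  have 1: "dspan 1 (a + b + 2 + sum_list w) (\<lambda>N n. if a > 0 then dsum_open N (ones (a - 1) ((b + 2) # w)) n / of_nat N else 0)"
    by (rule dspan_if, rule dspan_open_1) (use w in \<open>auto simp: ones_set ones_sum\<close>)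
  have 2: "dspan 1 (a + b + 2 + sum_list w) (\<lambda>N n. open_tail N (ones a [b + 2]) w n / of_nat N)"
    by (rule dspan_open_tail) (use w in \<open>auto simp: ones_set ones_sum\<close>)
  show ?thesis
    by (rule dspan_cong[OF dspan_diff[OF dspan_add[OF dspan_mono[OF mod_square, of 1] 1] 2]]) auto
qed

text \<open>The shift identity divided by z^2 with z = N: x1 and x2 are the blocks for a - 1 and b -
  1, e1 and e2 their leading terms. The term e2 occurs on both sides and drops out.\<close>

lemma block_shift_algebra:
  fixes z :: rat
  assumes "z \<noteq> 0" "z ^ 2 * x - z * x1 - z * x2 = z ^ 2 * e0 - z * d - z * e2 + e3 - e4"
  shows "(x1 - e1) / z + (x2 - e2) / z + e3 / z ^ 2 - e4 / z ^ 2 = x - e0 - e1 / z + d / z"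
proof -
  have *: "z ^ 2 * (y / z) = z * y" "z ^ 2 * (y / z ^ 2) = y" for y
    using assms(1) by (simp_all add: power2_eq_square)
  have "z ^ 2 * ((x1 - e1) / z + (x2 - e2) / z + e3 / z ^ 2 - e4 / z ^ 2) = z ^ 2 * (x - e0 - e1 / z + d / z)"
    unfolding distrib_left right_diff_distrib * using assms(2) by linarith
  thus ?thesis using assms(1) by simp
qed

text \<open>Divided by N^2, the shift identity contains the neighbours a - 1 and b - 1 with a factor
  1/N, so their leading terms suffice. That of b - 1 is matched on the right side; that of a - 1 is
  not, and remains as a first-order term.\<close>

lemma block_shift_mod_square:
  assumes w: "\<forall>x\<in>set w. 1 \<le> x"
  shows "dspan 2 (a + b + 2 + sum_list w) (\<lambda>N n. shifted_block N a b w n - dsum_open N (ones a ((b + 2) # w)) n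
     - (if a > 0 then dsum_open N (ones (a - 1) ((b + 2) # w)) n / of_nat N else 0)
     + open_tail N (ones a [b + 2]) w n / of_nat N)"
proof (induction "a + b" arbitrary: a b rule: less_induct)
  case less
  let ?k = "a + b + 2 + sum_list w"
  have 1: "dspan 2 ?k (\<lambda>N n. if a > 0 then (shifted_block N (a - 1) b w n - dsum_open N (ones (a - 1) ((b + 2) # w)) n) / of_nat N else 0)"
  proof (rule dspan_if)
    assume a: "a > 0"
    show "dspan 2 ?k (\<lambda>N n. (shifted_block N (a - 1) b w n - dsum_open N (ones (a - 1) ((b + 2) # w)) n) / of_nat N)"
      using dspan_div[OF block_shift_mod_linear[OF less[of "a - 1" b] w]] a by (simp add: numeral_2_eq_2)
  qed
  have 2: "dspan 2 ?k (\<lambda>N n. if b > 0 then (shifted_block N a (b - 1) w n - dsum_open N (ones a ((b + 1) # w)) n) / of_nat N else 0)"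
  proof (rule dspan_if)
    assume b: "b > 0"
    show "dspan 2 ?k (\<lambda>N n. (shifted_block N a (b - 1) w n - dsum_open N (ones a ((b + 1) # w)) n) / of_nat N)"
      using dspan_div[OF block_shift_mod_linear[OF less[of a "b - 1"] w]] b by (simp add: numeral_2_eq_2)
  qed
  have 3: "dspan 2 ?k (\<lambda>N n. if b = 0 \<and> (w = [] \<or> hd w \<noteq> 1) then dsum_open N (ones a w) n / of_nat N ^ 2 else 0)"
    by (rule dspan_if, rule dspan_open) (use w in \<open>auto simp: ones_set ones_sum\<close>)
  have 4: "dspan 2 ?k (\<lambda>N n. if a = 0 \<and> b = 0 then dsum_open N w n / of_nat N ^ 2 else 0)"
    by (rule dspan_if, rule dspan_open) (use w in auto)
  show ?case
  proof (rule dspan_cong[OF dspan_diff[OF dspan_add[OF dspan_add[OF 1 2] 3] 4]])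
    fix N n :: nat assume n: "1 \<le> n" "n \<le> N"
    define z where "z = (of_nat N :: rat)"
    have z: "z \<noteq> 0" using n by (simp add: z_def)
    define x1 where "x1 = (if a > 0 then shifted_block N (a - 1) b w n else 0)"
    define x2 where "x2 = (if b > 0 then shifted_block N a (b - 1) w n else 0)"
    define e0 where "e0 = dsum_open N (ones a ((b + 2) # w)) n"
    define e1 where "e1 = (if a > 0 then dsum_open N (ones (a - 1) ((b + 2) # w)) n else 0)"
    define e2 where "e2 = (if b > 0 then dsum_open N (ones a ((b + 1) # w)) n else 0)"
    define e3 where "e3 = (if b = 0 \<and> (w = [] \<or> hd w \<noteq> 1) then dsum_open N (ones a w) n else 0)"
    define e4 where "e4 = (if a = 0 \<and> b = 0 then dsum_open N w n else 0)"
    define d where "d = open_tail N (ones a [b + 2]) w n"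
    have "z ^ 2 * shifted_block N a b w n - z * x1 - z * x2 = z ^ 2 * e0 - z * d - z * e2 + e3 - e4"
      using shift_identity[OF n, of a b w] unfolding shift_lhs_def shift_rhs_def x1_def x2_def e0_def e2_def e3_def e4_def d_def z_def .
    from block_shift_algebra[OF z this, of e1]
    have "(x1 - e1) / z + (x2 - e2) / z + e3 / z ^ 2 - e4 / z ^ 2 = shifted_block N a b w n - e0 - e1 / z + d / z" .
    moreover have "(if a > 0 then (shifted_block N (a - 1) b w n - dsum_open N (ones (a - 1) ((b + 2) # w)) n) / z else 0) = (x1 - e1) / z"
      "(if b > 0 then (shifted_block N a (b - 1) w n - dsum_open N (ones a ((b + 1) # w)) n) / z else 0) = (x2 - e2) / z"
      "(if b = 0 \<and> (w = [] \<or> hd w \<noteq> 1) then dsum_open N (ones a w) n / z ^ 2 else 0) = e3 / z ^ 2"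
      "(if a = 0 \<and> b = 0 then dsum_open N w n / z ^ 2 else 0) = e4 / z ^ 2"
      "(if a > 0 then dsum_open N (ones (a - 1) ((b + 2) # w)) n / z else 0) = e1 / z"
      by (auto simp: x1_def x2_def e1_def e2_def e3_def e4_def)
    ultimately show "(if a > 0 then (shifted_block N (a - 1) b w n - dsum_open N (ones (a - 1) ((b + 2) # w)) n) / of_nat N else 0)
      + (if b > 0 then (shifted_block N a (b - 1) w n - dsum_open N (ones a ((b + 1) # w)) n) / of_nat N else 0)
      + (if b = 0 \<and> (w = [] \<or> hd w \<noteq> 1) then dsum_open N (ones a w) n / of_nat N ^ 2 else 0)
      - (if a = 0 \<and> b = 0 then dsum_open N w n / of_nat N ^ 2 else 0)
      = shifted_block N a b w n - dsum_open N (ones a ((b + 2) # w)) n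
     - (if a > 0 then dsum_open N (ones (a - 1) ((b + 2) # w)) n / of_nat N else 0)
     + open_tail N (ones a [b + 2]) w n / of_nat N"
      by (simp only: e0_def[symmetric] d_def[symmetric] z_def[symmetric])
  qed
qed

lemma block_shift_dspan:
  assumes w: "\<forall>x\<in>set w. 1 \<le> x"
  shows "dspan 0 (a + b + 2 + sum_list w) (\<lambda>N n. shifted_block N a b w n)"
proof -
  have "dspan 0 (a + b + 2 + sum_list w) (\<lambda>N n. dsum_open N (ones a ((b + 2) # w)) n)"
    by (rule dspan_open_0) (use w in \<open>auto simp: ones_set ones_sum\<close>)
  from dspan_add[OF dspan_mono[OF block_shift_mod_linear[OF block_shift_mod_square[OF w] w], of 0] this] show ?thesis
    by simp
qed

section \<open>The shift of a whole word, block by block\<close>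

definition apply_block :: "nat \<Rightarrow> nat \<Rightarrow> nat \<Rightarrow> (nat \<Rightarrow> rat) \<Rightarrow> nat \<Rightarrow> rat" where
  "apply_block a b N h = (letter1 (Suc N) ^^ a) (qsum (b + 2) h)"

lemma apply_block_0: "apply_block 0 b N h = qsum (b + 2) h"
  and apply_block_Suc: "apply_block (Suc a) b N h = letter1 (Suc N) (apply_block a b N h)"
  by (simp_all add: apply_block_def)

lemma apply_block_add: "apply_block a b N (\<lambda>m. f m + g m) = (\<lambda>n. apply_block a b N f n + apply_block a b N g n)"
  by (induction a) (simp_all add: apply_block_0 apply_block_Suc fun_eq_iff[of "qsum _ _"] fun_eq_iff[of "letter1 _ _"] qsum_add letter1_add)

lemma apply_block_cmult: "apply_block a b N (\<lambda>m. c * f m) = (\<lambda>n. c * apply_block a b N f n)"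
  by (induction a) (simp_all add: apply_block_0 apply_block_Suc fun_eq_iff[of "qsum _ _"] fun_eq_iff[of "letter1 _ _"] qsum_cmult letter1_cmult)

lemma apply_block_cong: "(\<And>m. 1 \<le> m \<Longrightarrow> m \<le> N \<Longrightarrow> f m = g m) \<Longrightarrow> n \<le> N \<Longrightarrow> apply_block a b N f n = apply_block a b N g n"
proof (induction a arbitrary: n)
  case 0
  thus ?case by (auto simp: apply_block_def intro: qsum_cong)
next
  case (Suc a)
  thus ?case by (auto simp: apply_block_def intro: letter1_cong)
qed

lemma apply_block_zero: "apply_block a b N (\<lambda>m. 0) = (\<lambda>n. 0)"
  using apply_block_cmult[of a b N 0 "\<lambda>_. 0"] by simp

lemma apply_block_open: "apply_block a b N (dsum_open N w) = shifted_block N a b w"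
  by (simp add: apply_block_def shifted_block_def)

text \<open>Powers of 1/N commute with the block operator, so the order is kept. For n \<le> N the
  operator only evaluates its argument up to n, which makes the comparison on 1 \<le> n \<le> N
  sufficient.\<close>

lemma dspan_apply_block: "dspan d k h \<Longrightarrow> dspan d (a + b + 2 + k) (\<lambda>N. apply_block a b N (h N))"
proof (induction rule: dspan.induct)
  case dspan_zero
  show ?case by (simp add: apply_block_zero dspan.dspan_zero)
next
  case (dspan_add f g)
  thus ?case by (simp add: apply_block_add dspan.dspan_add)
next
  case (dspan_base s v c)
  have "dspan (0 + s) (a + b + 2 + sum_list v + s) (\<lambda>N n. c * (shifted_block N a b v n / of_nat N ^ s))"
    by (rule dspan_cmult_div[OF block_shift_dspan]) (use dspan_base in auto)
  moreover have "apply_block a b N (\<lambda>n. c * (dsum_open N v n / of_nat N ^ s)) = (\<lambda>n. c * (shifted_block N a b v n / of_nat N ^ s))" for N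
    using apply_block_cmult[of a b N "c / of_nat N ^ s" "dsum_open N v"] by (simp add: apply_block_open)
  moreover have "a + b + 2 + sum_list v + s = a + b + 2 + k" using dspan_base by simp
  ultimately have "dspan s (a + b + 2 + k) (\<lambda>N. apply_block a b N (\<lambda>n. c * (dsum_open N v n / of_nat N ^ s)))"
    by (simp only: add_0)
  thus ?case using dspan_base(1) by (rule dspan_mono)
next
  case (dspan_cong f g)
  show ?case by (rule dspan.dspan_cong[OF dspan_cong.IH]) (auto intro: apply_block_cong dspan_cong)
qed

lemma dsum_ones: "dsum N (ones a ((b + 2) # w)) = (letter1 N ^^ a) (qsum (b + 2) (dsum N w))"
  by (induction a) auto

text \<open>The innermost block of ones acts on the constant 1, whose value at m = 1 survives the
  index shift as 1/N; every further letter carries this correction along.\<close>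

lemma dsum_shift_ones_nil:
  assumes "1 \<le> n" "n \<le> N"
  shows "dsum (Suc N) (ones (Suc a) []) n = dsum_open N (ones (Suc a) []) n + dsum (Suc N) (ones a []) n / of_nat N"
  using assms
proof (induction a arbitrary: n)
  case 0
  have "letter1 (Suc N) (dsum (Suc N) []) n = letter1 (Suc N) (dsum_open N []) n" by (rule letter1_cong) simp
  thus ?case using 0 by (simp add: letter1_open)
next
  case (Suc a)
  have "dsum (Suc N) (ones (Suc (Suc a)) []) n = letter1 (Suc N) (dsum (Suc N) (ones (Suc a) [])) n" by simp
  also have "\<dots> = letter1 (Suc N) (\<lambda>n. dsum_open N (ones (Suc a) []) n + 1 / of_nat N * dsum (Suc N) (ones a []) n) n"
    by (rule letter1_cong) (use Suc in auto)
  also have "\<dots> = dsum_open N (ones (Suc (Suc a)) []) n + 1 / of_nat N * letter1 (Suc N) (dsum (Suc N) (ones a [])) n"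
    unfolding letter1_add letter1_cmult letter1_open_ones[OF zero_less_Suc Suc.prems] ..
  finally show ?case by simp
qed

lemma word_cases:
  assumes "\<forall>x\<in>set w. (1::nat) \<le> x"
  obtains a where "w = ones a []" | a b v where "w = ones a ((b + 2) # v)" "\<forall>x\<in>set v. 1 \<le> x" "length v < length w"
  using assms
proof (induction w arbitrary: thesis)
  case Nil
  show ?case by (rule Nil(1)[of 0]) simp
next
  case (Cons k w)
  show ?case
  proof (cases "k = 1")
    case True
    show ?thesis
    proof (rule Cons.IH)
      fix a assume "w = ones a []"
      thus thesis using Cons.prems(1)[of "Suc a"] True by simp
    next
      fix a b v assume "w = ones a ((b + 2) # v)" "\<forall>x\<in>set v. 1 \<le> x" "length v < length w"
      thus thesis using Cons.prems(2)[of "Suc a" b v] True by simp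
    qed (use Cons.prems in auto)
  next
    case False
    thus thesis using Cons.prems(2)[of 0 "k - 2" w] Cons.prems(3) by (auto simp: ones_def)
  qed
qed

text \<open>Of all first-order terms only the one that removes an outermost 1 remains. A block of
  ones further inside leaves a term of the same form, but crossing the next letter b + 2 outwards
  creates its negative.\<close>

lemma dsum_shift_mod_square:
  assumes "\<forall>x\<in>set w. 1 \<le> x"
  shows "dspan 2 (sum_list w) (\<lambda>N n. dsum (Suc N) w n - dsum_open N w n - open_tail N [] w n / of_nat N)"
  using assms
proof (induction "length w" arbitrary: w rule: less_induct)
  case less
  show ?case using less.prems
  proof (cases w rule: word_cases)
    case (1 a)
    have r1: "dspan 1 c (\<lambda>N n. dsum (Suc N) (ones c []) n - dsum_open N (ones c []) n)" for c
    proof (induction c)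
      case 0
      show ?case by (simp add: dspan_zero)
    next
      case (Suc c)
      have "dspan 0 c (\<lambda>N n. dsum_open N (ones c []) n)"
        by (rule dspan_open_0) (auto simp: ones_set ones_sum)
      from dspan_div[OF dspan_add[OF dspan_mono[OF Suc, of 0] this]] show ?case
        by (intro dspan_cong[where g = "\<lambda>N n. dsum (Suc N) (ones (Suc c) []) n - dsum_open N (ones (Suc c) []) n"])
          (auto simp: dsum_shift_ones_nil simp del: ones_simps)
    qed
    show ?thesis
    proof (cases a)
      case 0
      thus ?thesis by (simp add: 1 dspan_zero)
    next
      case (Suc c)
      have d: "open_tail N [] w n = dsum_open N (ones c []) n" for N n by (simp add: 1 Suc)
      have s: "sum_list w = Suc c" by (simp add: 1 Suc ones_sum)
      have "dsum (Suc N) w n = dsum_open N w n + dsum (Suc N) (ones c []) n / of_nat N" if "1 \<le> n" "n \<le> N" for N n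
        using dsum_shift_ones_nil[OF that] 1 Suc by simp
      with dspan_div[OF r1[of c]] show ?thesis unfolding s d numeral_2_eq_2 One_nat_def
        by (elim dspan_cong) (simp add: diff_divide_distrib)
    qed
  next
    case (2 a b v)
    let ?k = "sum_list w"
    have k: "?k = a + b + 2 + sum_list v" by (simp add: 2 ones_sum)
    have i1: "dspan 2 ?k (\<lambda>N. apply_block a b N (\<lambda>n. dsum (Suc N) v n - dsum_open N v n - open_tail N [] v n / of_nat N))"
      unfolding k by (rule dspan_apply_block, rule less.hyps) (use 2 in auto)
    \<comment> \<open>The cancellation: for \<open>v = 1 # u\<close>, the term inherited from
      \<open>v\<close> and the term created by crossing b + 2 both have leading part
      \<open>dsum_open N (ones a ((b + 2) # u)) n / N\<close>.\<close>
    have i3: "dspan 2 ?k (\<lambda>N n. (apply_block a b N (open_tail N [] v) n - open_tail N (ones a [b + 2]) v n) / of_nat N)"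
    proof (cases "v \<noteq> [] \<and> hd v = 1")
      case True
      then obtain u where v: "v = 1 # u" by (cases v) auto
      have "open_tail N x v = dsum_open N (x @ u)" for N x by (auto simp: v open_tail_def)
      moreover have "dspan 2 ?k (\<lambda>N n. (shifted_block N a b u n - dsum_open N (ones a ((b + 2) # u)) n) / of_nat N)"
        using dspan_div[OF block_shift_mod_linear[OF block_shift_mod_square, of u a b]] 2(2) by (simp add: k v numeral_2_eq_2)
      ultimately show ?thesis by (simp add: apply_block_open ones_append)
    next
      case False
      hence "open_tail N x v = (\<lambda>_. 0)" for N x by (cases v) auto
      thus ?thesis by (simp add: apply_block_zero dspan_zero)
    qed
    have "dspan 2 ?k (\<lambda>N n. apply_block a b N (\<lambda>n. dsum (Suc N) v n - dsum_open N v n - open_tail N [] v n / of_nat N) n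
        + (shifted_block N a b v n - dsum_open N (ones a ((b + 2) # v)) n
     - (if a > 0 then dsum_open N (ones (a - 1) ((b + 2) # v)) n / of_nat N else 0)
     + open_tail N (ones a [b + 2]) v n / of_nat N)
        + (apply_block a b N (open_tail N [] v) n - open_tail N (ones a [b + 2]) v n) / of_nat N)"
      using dspan_add[OF dspan_add[OF i1 block_shift_mod_square[OF 2(2), of a b, folded k]] i3] .
    moreover have "dsum (Suc N) w n = apply_block a b N (\<lambda>n. dsum (Suc N) v n - dsum_open N v n - open_tail N [] v n / of_nat N) n
       + shifted_block N a b v n + apply_block a b N (open_tail N [] v) n / of_nat N" for N n
    proof -
      define r where "r = (\<lambda>n. dsum (Suc N) v n - dsum_open N v n - open_tail N [] v n / of_nat N)"
      have "dsum (Suc N) v = (\<lambda>n. r n + (dsum_open N v n + (1 / of_nat N) * open_tail N [] v n))" by (simp add: r_def)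
      hence "apply_block a b N (dsum (Suc N) v) n = apply_block a b N r n + (shifted_block N a b v n + (1 / of_nat N) * apply_block a b N (open_tail N [] v) n)"
        by (simp only: apply_block_add apply_block_cmult apply_block_open)
      moreover have "dsum (Suc N) w n = apply_block a b N (dsum (Suc N) v) n"
        by (simp only: 2(1) dsum_ones apply_block_def)
      ultimately show ?thesis by (simp add: r_def)
    qed
    moreover have "open_tail N [] w n = (if a > 0 then dsum_open N (ones (a - 1) ((b + 2) # v)) n else 0)" for N n
      by (cases a) (simp_all add: 2(1))
    ultimately show ?thesis
      by (elim dspan_cong) (simp add: 2(1) diff_divide_distrib)
  qed
qed

section \<open>Reduction to indices with entries at least 2\<close>

inductive mspan :: "nat \<Rightarrow> (nat \<Rightarrow> rat) \<Rightarrow> bool" for k where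
  mspan_zero: "mspan k (\<lambda>N. 0)"
| mspan_add: "mspan k f \<Longrightarrow> mspan k g \<Longrightarrow> mspan k (\<lambda>N. f N + g N)"
| mspan_base: "\<forall>x\<in>set w. 2 \<le> x \<Longrightarrow> sum_list w = k \<Longrightarrow> mspan k (\<lambda>N. c * mhs w N)"
| mspan_cong: "mspan k f \<Longrightarrow> (\<And>N. 1 \<le> N \<Longrightarrow> f N = g N) \<Longrightarrow> mspan k g"

text \<open>The shape required of a difference f(N + 1) - f(N): with s \<ge> 2, summing over N
  prefixes an entry s that is allowed in \<open>mspan\<close>.\<close>

inductive dmspan :: "nat \<Rightarrow> (nat \<Rightarrow> rat) \<Rightarrow> bool" for k where
  dmspan_zero: "dmspan k (\<lambda>N. 0)"
| dmspan_add: "dmspan k f \<Longrightarrow> dmspan k g \<Longrightarrow> dmspan k (\<lambda>N. f N + g N)"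
| dmspan_base: "2 \<le> s \<Longrightarrow> s + j = k \<Longrightarrow> mspan j h \<Longrightarrow> dmspan k (\<lambda>N. c * (h N / of_nat N ^ s))"
| dmspan_cong: "dmspan k f \<Longrightarrow> (\<And>N. 1 \<le> N \<Longrightarrow> f N = g N) \<Longrightarrow> dmspan k g"

lemma dmspan_div: "2 \<le> s \<Longrightarrow> s + j = k \<Longrightarrow> mspan j h \<Longrightarrow> dmspan k (\<lambda>N. h N / of_nat N ^ s)"
  using dmspan_base[of s j k h 1] by simp

lemma dmspan_cmult_div: "dmspan k f \<Longrightarrow> dmspan (k + j) (\<lambda>N. c * (f N / of_nat N ^ j))"
proof (induction rule: dmspan.induct)
  case dmspan_zero
  show ?case using dmspan.dmspan_zero by simp
next
  case (dmspan_add f g)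
  show ?case by (rule dmspan_cong[OF dmspan.dmspan_add[OF dmspan_add.IH]]) (simp add: add_divide_distrib distrib_left)
next
  case (dmspan_base s i h c')
  have "dmspan (k + j) (\<lambda>N. (c * c') * (h N / of_nat N ^ (s + j)))"
    by (rule dmspan.dmspan_base) (use dmspan_base in auto)
  thus ?case by (simp add: power_add mult.assoc)
next
  case (dmspan_cong f g)
  show ?case by (rule dmspan.dmspan_cong[OF dmspan_cong.IH]) (simp add: dmspan_cong)
qed

lemma dmspan_uminus: "dmspan k f \<Longrightarrow> dmspan k (\<lambda>N. - f N)"
  using dmspan_cmult_div[of k f 0 "-1"] by simp

lemma dmspan_sum: "finite A \<Longrightarrow> (\<And>i. i \<in> A \<Longrightarrow> dmspan k (f i)) \<Longrightarrow> dmspan k (\<lambda>N. \<Sum>i\<in>A. f i N)"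
  by (induction A rule: finite_induct) (auto intro: dmspan_zero dmspan_add)

lemma mspan_partial_sums_div:
  assumes "mspan j h" "2 \<le> s"
  shows "mspan (s + j) (\<lambda>N. \<Sum>M\<in>{1..<N}. h M / of_nat M ^ s)"
  using assms(1)
proof induction
  case mspan_zero
  show ?case using mspan.mspan_zero by simp
next
  case (mspan_add f g)
  show ?case by (rule mspan_cong[OF mspan.mspan_add[OF mspan_add.IH]]) (simp add: add_divide_distrib sum.distrib)
next
  case (mspan_base w c)
  have "mspan (s + j) (\<lambda>N. c * mhs (s # w) N)" by (rule mspan.mspan_base) (use mspan_base assms in auto)
  thus ?case by (simp add: sum_distrib_left)
next
  case (mspan_cong f g)
  show ?case by (rule mspan.mspan_cong[OF mspan_cong.IH]) (simp add: mspan_cong)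
qed

lemma mspan_cmult: "mspan k f \<Longrightarrow> mspan k (\<lambda>N. c * f N)"
proof (induction rule: mspan.induct)
  case mspan_zero
  show ?case using mspan.mspan_zero by simp
next
  case (mspan_add f g)
  show ?case by (rule mspan_cong[OF mspan.mspan_add[OF mspan_add.IH]]) (simp add: distrib_left)
next
  case (mspan_base w c')
  show ?case using mspan.mspan_base[OF mspan_base, of "c * c'"] by (simp add: mult.assoc)
next
  case (mspan_cong f g)
  show ?case by (rule mspan.mspan_cong[OF mspan_cong.IH]) (simp add: mspan_cong)
qed

lemma mspan_partial_sums:
  "dmspan k g \<Longrightarrow> mspan k (\<lambda>N. \<Sum>M\<in>{1..<N}. g M)"
proof (induction rule: dmspan.induct)
  case dmspan_zero
  show ?case using mspan_zero by simp
next
  case (dmspan_add f g)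
  show ?case by (rule mspan_cong[OF mspan_add[OF dmspan_add.IH]]) (simp add: sum.distrib)
next
  case (dmspan_base s j h c)
  thus ?case using mspan_cmult[OF mspan_partial_sums_div[of j h s], of c] by (simp add: sum_distrib_left)
next
  case (dmspan_cong f g)
  show ?case by (rule mspan_cong[OF dmspan_cong.IH]) (simp add: dmspan_cong)
qed

lemma mspan_of_difference:
  assumes "f 1 = 0" "dmspan k (\<lambda>N. f (Suc N) - f N)"
  shows "mspan k f"
proof (rule mspan_cong[OF mspan_partial_sums[OF assms(2)]])
  fix N :: nat assume "1 \<le> N"
  thus "(\<Sum>M\<in>{1..<N}. f (Suc M) - f M) = f N"
    by (induction N rule: dec_induct) (simp_all add: assms(1)[unfolded One_nat_def])
qed

section \<open>The outermost summation\<close>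

definition last_sum :: "nat \<Rightarrow> (nat \<Rightarrow> nat \<Rightarrow> rat) \<Rightarrow> nat \<Rightarrow> rat" where
  "last_sum b e N = qsum (b + 2) (e N) (Suc N)"

text \<open>Iterates (x + y)/(x y) = 1/x + 1/y. With x = m and y = N - m the powers of x + y = N do
  not depend on m and leave the sum over m.\<close>

lemma geometric_partial_fractions:
  fixes x y :: rat
  assumes "x \<noteq> 0" "y \<noteq> 0" "x + y \<noteq> 0"
  shows "1 / (x ^ (b + 1) * y) = (\<Sum>j\<in>{2..b + 1}. 1 / (x ^ j * (x + y) ^ (b + 2 - j))) + (1 / x + 1 / y) / (x + y) ^ (b + 1)"
proof (induction b)
  case 0
  have "1 / x + 1 / y = (x + y) / (x * y)" using assms by (simp add: field_simps)
  thus ?case using assms by simp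
next
  case (Suc b)
  have *: "{2..Suc b + 1} = insert (Suc b + 1) {2..b + 1}" by auto
  have "1 / (x ^ (Suc b + 1) * y) = 1 / (x ^ (b + 1) * y) / (x + y) + 1 / (x ^ (b + 2) * (x + y))"
  proof -
    have "1 / (p * y) / s + 1 / (p * x * s) = (x + y) / (p * x * y * s)" if "p \<noteq> 0" "s \<noteq> 0" for p s
      using that assms(1,2) by (simp add: field_simps)
    from this[of "x ^ (b + 1)" "x + y"] show ?thesis using assms by (simp add: mult_ac)
  qed
  also have "1 / (x ^ (b + 1) * y) / (x + y)
     = (\<Sum>j\<in>{2..b + 1}. 1 / (x ^ j * (x + y) ^ (Suc b + 2 - j))) + (1 / x + 1 / y) / (x + y) ^ (Suc b + 1)"
    unfolding Suc add_divide_distrib sum_divide_distrib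
    by (intro arg_cong2[where f = "(+)"] sum.cong) (auto simp: Suc_diff_le mult.assoc)
  finally show ?case by (simp add: *)
qed

lemma qsum_Suc: "1 \<le> n \<Longrightarrow> qsum k h (Suc n) = qsum k h n + h n / of_nat n ^ k"
  by (simp add: qsum_def)

lemma last_sum_open_ne1:
  assumes "1 \<le> N" "v = [] \<or> hd v \<noteq> 1"
  shows "last_sum b (\<lambda>N. dsum_open N v) N = dsum N ((b + 2) # v) N + dsum N v N / of_nat N ^ (b + 2)"
proof -
  have "dsum_open N v m = dsum N v m" for m using assms(2) by (cases v) auto
  hence "dsum_open N v = dsum N v" by auto
  thus ?thesis using assms(1) by (simp add: last_sum_def qsum_Suc)
qed

text \<open>The top term m = N contributes \<open>dsum_open N (1 # u) N / N^(b + 2)\<close>, which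
  is exactly the last part of the partial fractions of the missing diagonal terms. So no word with
  head 1 survives.\<close>

lemma last_sum_open_1:
  assumes N: "1 \<le> N"
  shows "last_sum b (\<lambda>N. dsum_open N (1 # u)) N = dsum N ((b + 2) # 1 # u) N
     - (\<Sum>j\<in>{2..b + 2}. dsum N (j # u) N / of_nat N ^ (b + 3 - j))"
proof -
  have 1: "qsum (b + 2) (dsum_open N (1 # u)) N = dsum N ((b + 2) # 1 # u) N
      - (\<Sum>m\<in>{1..<N}. dsum N u m * (1 / (of_nat m ^ (b + 2) * of_nat (N - m))))"
  proof -
    have "qsum (b + 2) (dsum_open N (1 # u)) N
      = (\<Sum>m\<in>{1..<N}. dsum N (1 # u) m / of_nat m ^ (b + 2) - dsum N u m * (1 / (of_nat m ^ (b + 2) * of_nat (N - m))))"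
      unfolding qsum_def
      by (rule sum.cong) (auto simp: dsum_open_eq_dsum diff_divide_distrib mult.commute simp del: dsum.simps)
    thus ?thesis by (simp add: sum_subtractf qsum_def)
  qed
  have "(\<Sum>m\<in>{1..<N}. dsum N u m * (1 / (of_nat m ^ (b + 2) * of_nat (N - m))))
     = (\<Sum>m\<in>{1..<N}. (\<Sum>j\<in>{2..b + 2}. dsum N u m / of_nat m ^ j / of_nat N ^ (b + 3 - j))
         + dsum N u m * (1 / of_nat m + 1 / of_nat (N - m)) / of_nat N ^ (b + 2))"
  proof (rule sum.cong[OF refl])
    fix m assume "m \<in> {1..<N}"
    hence m: "1 \<le> m" "m < N" by auto
    have eq: "(of_nat N :: rat) = of_nat m + of_nat (N - m)" using m by (simp add: of_nat_diff)
    have nz: "(of_nat m :: rat) \<noteq> 0" "(of_nat (N - m) :: rat) \<noteq> 0" "(of_nat m + of_nat (N - m) :: rat) \<noteq> 0"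
      using m eq by auto
    show "dsum N u m * (1 / (of_nat m ^ (b + 2) * of_nat (N - m)))
       = (\<Sum>j\<in>{2..b + 2}. dsum N u m / of_nat m ^ j / of_nat N ^ (b + 3 - j))
         + dsum N u m * (1 / of_nat m + 1 / of_nat (N - m)) / of_nat N ^ (b + 2)"
      using geometric_partial_fractions[OF nz, of "Suc b", folded eq]
      by (simp add: distrib_left sum_distrib_left numeral_3_eq_3 numeral_2_eq_2)
  qed
  also have "\<dots> = (\<Sum>j\<in>{2..b + 2}. dsum N (j # u) N / of_nat N ^ (b + 3 - j)) + dsum_open N (1 # u) N / of_nat N ^ (b + 2)"
  proof -
    have "(\<Sum>m\<in>{1..<N}. \<Sum>j\<in>{2..b + 2}. dsum N u m / of_nat m ^ j / of_nat N ^ (b + 3 - j))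
      = (\<Sum>j\<in>{2..b + 2}. \<Sum>m\<in>{1..<N}. dsum N u m / of_nat m ^ j / of_nat N ^ (b + 3 - j))"
      by (rule sum.swap)
    also have "\<dots> = (\<Sum>j\<in>{2..b + 2}. dsum N (j # u) N / of_nat N ^ (b + 3 - j))"
      by (rule sum.cong) (auto simp: qsum_def sum_divide_distrib)
    finally show ?thesis by (simp add: sum.distrib dsum_open_letter1 sum_divide_distrib)
  qed
  finally show ?thesis using N 1 by (simp add: last_sum_def qsum_Suc)
qed

definition admissible_word :: "nat list \<Rightarrow> bool" where
  "admissible_word w \<longleftrightarrow> (\<forall>x\<in>set w. 1 \<le> x) \<and> (w = [] \<or> hd w \<noteq> 1)"

text \<open>The summand j = b + 2 of \<open>last_sum_open_1\<close> is the only one of first order,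
  and the conditional takes it out. The remaining words are of smaller weight and do not begin with
  1, so the induction hypothesis covers them.\<close>

lemma last_sum_open_dmspan:
  assumes v: "\<forall>x\<in>set v. 1 \<le> x" and K: "b + 2 + sum_list v = K"
    and IH: "\<And>w. admissible_word w \<Longrightarrow> sum_list w < K \<Longrightarrow> mspan (sum_list w) (\<lambda>N. dsum N w N)"
  shows "dmspan K (\<lambda>N. last_sum b (\<lambda>N. dsum_open N v) N - dsum N ((b + 2) # v) N
     + (if v \<noteq> [] \<and> hd v = 1 then dsum N ((b + 2) # tl v) N / of_nat N else 0))"
proof (cases "v \<noteq> [] \<and> hd v = 1")
  case True
  then obtain u where u: "v = 1 # u" by (cases v) auto
  have "dmspan K (\<lambda>N. - (\<Sum>j\<in>{2..b + 1}. dsum N (j # u) N / of_nat N ^ (b + 3 - j)))"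
  proof (intro dmspan_uminus dmspan_sum)
    fix j assume j: "j \<in> {2..b + 1}"
    have "mspan (sum_list (j # u)) (\<lambda>N. dsum N (j # u) N)"
      by (rule IH) (use j v K u in \<open>auto simp: admissible_word_def\<close>)
    thus "dmspan K (\<lambda>N. dsum N (j # u) N / of_nat N ^ (b + 3 - j))"
      by (rule dmspan_div[rotated 2]) (use j K u in auto)
  qed simp
  moreover have *: "{2..b + 2} = insert (b + 2) {2..b + 1}" by auto
  have **: "b + 3 - (b + 2) = 1" by simp
  ultimately show ?thesis
    by (elim dmspan_cong) (simp only: u last_sum_open_1 *, simp add: ** del: dsum.simps)
next
  case False
  hence "admissible_word v" using v by (auto simp: admissible_word_def)
  hence "dmspan K (\<lambda>N. dsum N v N / of_nat N ^ (b + 2))"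
    by (intro dmspan_div[of "b + 2" "sum_list v"] IH) (use K in auto)
  thus ?thesis
    by (elim dmspan_cong) (use False in \<open>auto simp: last_sum_open_ne1 simp del: dsum.simps\<close>)
qed

lemma last_sum_add: "last_sum b (\<lambda>N n. f N n + g N n) N = last_sum b f N + last_sum b g N"
  by (simp add: last_sum_def qsum_add)

lemma last_sum_cmult: "last_sum b (\<lambda>N n. c N * f N n) N = c N * last_sum b f N"
  by (simp add: last_sum_def qsum_cmult)

text \<open>A remainder already carries 1/N^s with s \<ge> 2, so every term of its last summation
  lies in \<open>dmspan\<close>, including the leading and the first-order one.\<close>

lemma last_sum_dspan_dmspan:
  assumes "dspan 2 k e"
    and IH: "\<And>w. admissible_word w \<Longrightarrow> sum_list w < b + 2 + k \<Longrightarrow> mspan (sum_list w) (\<lambda>N. dsum N w N)"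
  shows "dmspan (b + 2 + k) (last_sum b e)"
  using assms(1)
proof induction
  case dspan_zero
  show ?case using dmspan_zero by (simp add: last_sum_def qsum_def)
next
  case (dspan_add f g)
  show ?case by (rule dmspan_cong[OF dmspan_add[OF dspan_add.IH]]) (simp add: last_sum_add)
next
  case (dspan_base s v c)
  let ?K = "b + 2 + sum_list v"
  have K: "?K + s = b + 2 + k" using dspan_base by simp
  have 1: "dmspan (b + 2 + k) (\<lambda>N. dsum N ((b + 2) # v) N / of_nat N ^ s)"
  proof (rule dmspan_div)
    show "mspan (sum_list ((b + 2) # v)) (\<lambda>N. dsum N ((b + 2) # v) N)"
      by (rule IH) (use dspan_base in \<open>auto simp: admissible_word_def\<close>)
  qed (use dspan_base in auto)
  have 2: "dmspan (b + 2 + k) (\<lambda>N. - ((if v \<noteq> [] \<and> hd v = 1 then dsum N ((b + 2) # tl v) N / of_nat N else 0) / of_nat N ^ s))"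
  proof (cases "v \<noteq> [] \<and> hd v = 1")
    case True
    then obtain u where u: "v = 1 # u" by (cases v) auto
    have "mspan (sum_list ((b + 2) # u)) (\<lambda>N. dsum N ((b + 2) # u) N)"
      by (rule IH) (use dspan_base u in \<open>auto simp: admissible_word_def\<close>)
    hence "dmspan (b + 2 + k) (\<lambda>N. dsum N ((b + 2) # u) N / of_nat N ^ (s + 1))"
      by (rule dmspan_div[rotated 2]) (use dspan_base u in auto)
    from dmspan_uminus[OF this] show ?thesis by (simp add: u del: dsum.simps)
  next
    case False
    show ?thesis unfolding if_not_P[OF False] by (simp add: dmspan_zero)
  qed
  have 3: "dmspan (b + 2 + k) (\<lambda>N. 1 * ((last_sum b (\<lambda>N. dsum_open N v) N - dsum N ((b + 2) # v) N
     + (if v \<noteq> [] \<and> hd v = 1 then dsum N ((b + 2) # tl v) N / of_nat N else 0)) / of_nat N ^ s))"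
    unfolding K[symmetric]
    by (rule dmspan_cmult_div[OF last_sum_open_dmspan]) (use dspan_base IH in auto)
  have "dmspan (b + 2 + k + 0) (\<lambda>N. c * ((last_sum b (\<lambda>N. dsum_open N v) N / of_nat N ^ s) / of_nat N ^ 0))"
    by (rule dmspan_cmult_div, rule dmspan_cong[OF dmspan_add[OF dmspan_add[OF 3 2] 1]])
      (simp add: add_divide_distrib diff_divide_distrib del: dsum.simps)
  moreover have "last_sum b (\<lambda>N n. c * (dsum_open N v n / of_nat N ^ s)) = (\<lambda>N. c * (last_sum b (\<lambda>N. dsum_open N v) N / of_nat N ^ s))"
    using last_sum_cmult[of b "\<lambda>N. c / of_nat N ^ s" "\<lambda>N. dsum_open N v"] by auto
  ultimately show ?case by simp
next
  case (dspan_cong f g)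
  show ?case
    by (rule dmspan_cong[OF dspan_cong.IH]) (auto simp: last_sum_def dspan_cong intro!: qsum_cong)
qed

theorem dsum_mspan: "admissible_word w \<Longrightarrow> mspan (sum_list w) (\<lambda>N. dsum N w N)"
proof (induction "sum_list w" arbitrary: w rule: less_induct)
  case less
  show ?case
  proof (cases w)
    case Nil
    thus ?thesis using mspan_base[of "[]" 0 1] by simp
  next
    case (Cons k w')
    define b where "b = k - 2"
    have k: "k = b + 2" using less.prems Cons by (auto simp: admissible_word_def b_def)
    have w': "\<forall>x\<in>set w'. 1 \<le> x" using less.prems Cons by (auto simp: admissible_word_def)
    let ?K = "b + 2 + sum_list w'"
    have K: "sum_list w = ?K" using Cons k by simp
    have IH: "mspan (sum_list v) (\<lambda>N. dsum N v N)" if "admissible_word v" "sum_list v < ?K" for v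
      by (rule less.hyps) (use that K in auto)
    define r where "r = (\<lambda>N n. dsum (Suc N) w' n - dsum_open N w' n - open_tail N [] w' n / of_nat N)"
    have i1: "dmspan ?K (last_sum b r)"
      unfolding r_def by (rule last_sum_dspan_dmspan[OF dsum_shift_mod_square[OF w'] IH])
    \<comment> \<open>The surviving first-order term: the last summation of
      \<open>dsum_open N w'\<close> produces -\<open>?h\<close>, and the letter 1 that the shift
      removes from \<open>w'\<close> produces +\<open>?h\<close>.\<close>
    let ?h = "\<lambda>N. if w' \<noteq> [] \<and> hd w' = 1 then dsum N ((b + 2) # tl w') N / of_nat N else 0"
    have i2: "dmspan ?K (\<lambda>N. last_sum b (\<lambda>N. dsum_open N w') N - dsum N ((b + 2) # w') N + ?h N)"
      by (rule last_sum_open_dmspan[OF w' refl IH])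
    have i3: "dmspan ?K (\<lambda>N. last_sum b (\<lambda>N. open_tail N [] w') N / of_nat N - ?h N)"
    proof (cases "w' \<noteq> [] \<and> hd w' = 1")
      case True
      then obtain u where u: "w' = 1 # u" by (cases w') auto
      have d: "open_tail N [] w' = dsum_open N u" for N by (auto simp: u open_tail_def)
      let ?hu = "\<lambda>N. if u \<noteq> [] \<and> hd u = 1 then dsum N ((b + 2) # tl u) N / of_nat N else 0"
      have j1: "dmspan (b + 2 + sum_list u + 1) (\<lambda>N. 1 * ((last_sum b (\<lambda>N. dsum_open N u) N - dsum N ((b + 2) # u) N + ?hu N) / of_nat N ^ 1))"
        by (rule dmspan_cmult_div[OF last_sum_open_dmspan[OF _ refl IH]]) (use w' u in auto)
      \<comment> \<open>A second leading 1 gives one more first-order term, which the factor 1/N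
        already present turns into one of order 2.\<close>
      have j2: "dmspan ?K (\<lambda>N. - (?hu N / of_nat N))"
      proof (cases "u \<noteq> [] \<and> hd u = 1")
        case True
        then obtain t where t: "u = 1 # t" by (cases u) auto
        have "mspan (sum_list ((b + 2) # t)) (\<lambda>N. dsum N ((b + 2) # t) N)"
          by (rule IH) (use w' u t in \<open>auto simp: admissible_word_def\<close>)
        hence "dmspan ?K (\<lambda>N. dsum N ((b + 2) # t) N / of_nat N ^ 2)"
          by (rule dmspan_div[rotated 2]) (use u t in auto)
        from dmspan_uminus[OF this] show ?thesis by (simp add: t power2_eq_square del: dsum.simps)
      next
        case False
        show ?thesis unfolding if_not_P[OF False] by (simp add: dmspan_zero)
      qed
      have K': "b + 2 + sum_list u + 1 = ?K" by (simp add: u)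
      show ?thesis
        by (rule dmspan_cong[OF dmspan_add[OF j1[unfolded K'] j2]])
          (simp only: d, simp add: u add_divide_distrib diff_divide_distrib del: dsum.simps)
    next
      case False
      hence "open_tail N x w' = (\<lambda>_. 0)" for N x by (cases w') auto
      thus ?thesis unfolding if_not_P[OF False] by (simp add: last_sum_def qsum_def dmspan_zero)
    qed
    show ?thesis unfolding K
    proof (rule mspan_of_difference)
      show "dsum 1 w 1 = 0" by (simp add: Cons k qsum_def)
      show "dmspan ?K (\<lambda>N. dsum (Suc N) w (Suc N) - dsum N w N)"
      proof (rule dmspan_cong[OF dmspan_add[OF dmspan_add[OF i1 i2] i3]])
        fix N :: nat
        have "dsum (Suc N) w' = (\<lambda>n. r N n + (dsum_open N w' n + 1 / of_nat N * open_tail N [] w' n))"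
          by (simp add: r_def)
        hence "dsum (Suc N) w (Suc N) = last_sum b (\<lambda>N n. r N n + (dsum_open N w' n + 1 / of_nat N * open_tail N [] w' n)) N"
          by (simp add: Cons k last_sum_def)
        also have "\<dots> = last_sum b r N + (last_sum b (\<lambda>N. dsum_open N w') N + last_sum b (\<lambda>N. open_tail N [] w') N / of_nat N)"
          unfolding last_sum_add last_sum_cmult[of b "\<lambda>N. 1 / of_nat N"] by simp
        finally show "last_sum b r N + (last_sum b (\<lambda>N. dsum_open N w') N - dsum N ((b + 2) # w') N + ?h N)
           + (last_sum b (\<lambda>N. open_tail N [] w') N / of_nat N - ?h N) = dsum (Suc N) w (Suc N) - dsum N w N"
          by (simp only: Cons k)
      qed
    qed
  qed
qed

section \<open>The diamond sums as iterated sums\<close>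

text \<open>The sentinel n turns the bound on the last entry into one more comparison of the same
  kind, so that the last entry can be peeled off and become the new sentinel.\<close>

definition bounded_chains :: "nat \<Rightarrow> nat \<Rightarrow> nat set \<Rightarrow> nat \<Rightarrow> nat list set" where
  "bounded_chains r N A n = {ns. length ns = r \<and> set ns \<subseteq> {1..<N} \<and>
      (\<forall>i<r. if i \<in> A then (ns @ [n]) ! i \<le> (ns @ [n]) ! Suc i else (ns @ [n]) ! i < (ns @ [n]) ! Suc i)}"

definition term_at :: "nat \<Rightarrow> nat list \<Rightarrow> nat set \<Rightarrow> nat list \<Rightarrow> rat" where
  "term_at N ks A ns = (\<Prod>i\<in>A. 1 / of_nat (N - ns ! i)) *
        (\<Prod>i\<in>{..<length ks} - A. 1 / (of_nat (ns ! i)) ^ (ks ! i))"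

lemma finite_chains: "finite (bounded_chains r N A n)"
  by (rule finite_subset[OF _ finite_lists_length_eq[of "{1..<N}" r]]) (auto simp: bounded_chains_def)

lemma append_in_chains:
  "ns @ [m] \<in> bounded_chains (Suc r) N A n \<longleftrightarrow> ns \<in> bounded_chains r N (A - {r}) m \<and> m \<in> {m. 1 \<le> m \<and> m < N \<and> (if r \<in> A then m \<le> n else m < n)}"
proof (cases "length ns = r")
  case True
  have "((ns @ [m]) @ [n]) ! i = (ns @ [m]) ! i \<and> ((ns @ [m]) @ [n]) ! Suc i = (ns @ [m]) ! Suc i" if "i < r" for i
    using that True by (simp add: nth_append)
  moreover have "((ns @ [m]) @ [n]) ! r = m" "((ns @ [m]) @ [n]) ! Suc r = n"
    using True by (simp_all add: nth_append)
  ultimately show ?thesis using True unfolding bounded_chains_def mem_Collect_eq All_less_Suc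
    by auto
qed (auto simp: bounded_chains_def)

lemma sum_chains:
  "sum g (bounded_chains (Suc r) N A n)
    = (\<Sum>m | 1 \<le> m \<and> m < N \<and> (if r \<in> A then m \<le> n else m < n). \<Sum>ns\<in>bounded_chains r N (A - {r}) m. g (ns @ [m]))"
proof -
  let ?M = "{m. 1 \<le> m \<and> m < N \<and> (if r \<in> A then m \<le> n else m < n)}"
  have fin: "finite ?M" by (rule finite_subset[of _ "{..<N}"]) auto
  have "sum g (bounded_chains (Suc r) N A n) = (\<Sum>(m, ns)\<in>Sigma ?M (bounded_chains r N (A - {r})). g (ns @ [m]))"
  proof (rule sum.reindex_bij_witness[where j = "\<lambda>ns. (last ns, butlast ns)" and i = "\<lambda>(m, ns). ns @ [m]"])
    fix ns assume ns: "ns \<in> bounded_chains (Suc r) N A n"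
    hence ne: "ns \<noteq> []" by (auto simp: bounded_chains_def)
    show "(case (last ns, butlast ns) of (m, ns) \<Rightarrow> ns @ [m]) = ns" using ne by simp
    show "(last ns, butlast ns) \<in> Sigma ?M (bounded_chains r N (A - {r}))"
      using ns append_in_chains[of "butlast ns" "last ns" r N A n] ne by simp
    show "(case (last ns, butlast ns) of (m, ns) \<Rightarrow> g (ns @ [m])) = g ns" using ne by simp
  next
    fix p assume "p \<in> Sigma ?M (bounded_chains r N (A - {r}))"
    thus "(case p of (m, ns) \<Rightarrow> ns @ [m]) \<in> bounded_chains (Suc r) N A n"
      by (auto simp del: One_nat_def simp: append_in_chains split: prod.splits)
  qed auto
  thus ?thesis using fin by (simp add: sum.Sigma finite_chains)
qed

lemma term_at_append:
  assumes "A \<subseteq> {..<length ks}" "length ns = length ks"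
  shows "term_at N (ks @ [k]) A (ns @ [m]) = term_at N ks A ns / of_nat m ^ k"
    and "term_at N (ks @ [k]) (insert (length ks) A) (ns @ [m]) = term_at N ks A ns / of_nat (N - m)"
proof -
  have fin: "finite A" using assms(1) finite_subset by blast
  have nA: "length ks \<notin> A" using assms(1) by auto
  have 1: "(\<Prod>i\<in>A. 1 / of_nat (N - (ns @ [m]) ! i)) = (\<Prod>i\<in>A. 1 / of_nat (N - ns ! i) :: rat)"
    by (rule prod.cong) (use assms in \<open>auto simp: nth_append\<close>)
  have 2: "(\<Prod>i\<in>{..<length ks} - A. 1 / (of_nat ((ns @ [m]) ! i)) ^ ((ks @ [k]) ! i))
    = (\<Prod>i\<in>{..<length ks} - A. 1 / (of_nat (ns ! i) :: rat) ^ (ks ! i))"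
    by (rule prod.cong) (use assms in \<open>auto simp: nth_append\<close>)
  have s1: "{..<length (ks @ [k])} - A = insert (length ks) ({..<length ks} - A)" using nA by auto
  have s2: "{..<length (ks @ [k])} - insert (length ks) A = {..<length ks} - A" by auto
  show "term_at N (ks @ [k]) A (ns @ [m]) = term_at N ks A ns / of_nat m ^ k"
    unfolding term_at_def s1 using 1 2 assms(2) by (simp add: nth_append)
  show "term_at N (ks @ [k]) (insert (length ks) A) (ns @ [m]) = term_at N ks A ns / of_nat (N - m)"
    unfolding term_at_def s2 using 1 2 assms(2) fin nA by (simp add: nth_append)
qed

lemma ones_pos_append: "ones_pos (ks @ [k]) = (if k = 1 then insert (length ks) (ones_pos ks) else ones_pos ks)"
  by (auto simp: ones_pos_def nth_append less_Suc_eq)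

lemma sum_Pow_insert:
  assumes "finite S" "a \<notin> S"
  shows "sum g (Pow (insert a S)) = (\<Sum>A\<in>Pow S. g A) + (\<Sum>A\<in>Pow S. g (insert a A))"
proof -
  have "inj_on (insert a) (Pow S)" using assms(2) by (auto simp: inj_on_def)
  moreover have "Pow S \<inter> insert a ` Pow S = {}" using assms(2) by auto
  ultimately show ?thesis
    using assms(1) by (simp add: Pow_insert sum.union_disjoint sum.reindex)
qed

text \<open>Subsets of the positions of ones in \<open>ks @ [1]\<close> split by whether they
  contain the last position: without it the last variable is summed strictly with 1/m, with it
  weakly with 1/(N - m), the two halves of \<open>letter1\<close>.\<close>

lemma chain_sum_eq_dsum:
  assumes "1 \<le> n" "n \<le> N"
  shows "(\<Sum>A\<in>Pow (ones_pos ks). \<Sum>ns\<in>bounded_chains (length ks) N A n. term_at N ks A ns) = dsum N (rev ks) n"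
  using assms
proof (induction ks arbitrary: n rule: rev_induct)
  case Nil
  have "bounded_chains 0 N {} n = {[]}" by (auto simp: bounded_chains_def)
  thus ?case by (simp add: ones_pos_def term_at_def)
next
  case (snoc k ks)
  let ?r = "length ks" and ?O = "ones_pos ks"
  have O: "?O \<subseteq> {..<?r}" by (auto simp: ones_pos_def)
  hence finO: "finite ?O" and rO: "?r \<notin> ?O" using finite_subset by auto
  have strict: "(\<Sum>A\<in>Pow ?O. \<Sum>ns\<in>bounded_chains (Suc ?r) N A n. term_at N (ks @ [k]) A ns) = qsum k (dsum N (rev ks)) n"
  proof -
    have "(\<Sum>A\<in>Pow ?O. \<Sum>ns\<in>bounded_chains (Suc ?r) N A n. term_at N (ks @ [k]) A ns)
      = (\<Sum>A\<in>Pow ?O. \<Sum>m\<in>{1..<n}. \<Sum>ns\<in>bounded_chains ?r N A m. term_at N ks A ns / of_nat m ^ k)"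
    proof (rule sum.cong[OF refl])
      fix A assume A: "A \<in> Pow ?O"
      hence r: "?r \<notin> A" "A - {?r} = A" using rO by auto
      have M: "{m. 1 \<le> m \<and> m < N \<and> m < n} = {1..<n}" using snoc.prems by auto
      show "(\<Sum>ns\<in>bounded_chains (Suc ?r) N A n. term_at N (ks @ [k]) A ns)
        = (\<Sum>m\<in>{1..<n}. \<Sum>ns\<in>bounded_chains ?r N A m. term_at N ks A ns / of_nat m ^ k)"
        unfolding sum_chains r(2) if_not_P[OF r(1)] M
        by (intro sum.cong refl term_at_append(1)) (use A O in \<open>auto simp: bounded_chains_def\<close>)
    qed
    also have "\<dots> = (\<Sum>m\<in>{1..<n}. \<Sum>A\<in>Pow ?O. \<Sum>ns\<in>bounded_chains ?r N A m. term_at N ks A ns / of_nat m ^ k)"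
      by (rule sum.swap)
    also have "\<dots> = (\<Sum>m\<in>{1..<n}. dsum N (rev ks) m / of_nat m ^ k)"
      by (rule sum.cong) (use snoc in \<open>auto simp flip: sum_divide_distrib\<close>)
    finally show ?thesis by (simp add: qsum_def)
  qed
  show ?case
  proof (cases "k = 1")
    case False
    thus ?thesis using strict by (simp add: ones_pos_append)
  next
    case True
    have "(\<Sum>A\<in>Pow ?O. \<Sum>ns\<in>bounded_chains (Suc ?r) N (insert ?r A) n. term_at N (ks @ [k]) (insert ?r A) ns)
      = (\<Sum>A\<in>Pow ?O. \<Sum>m | 1 \<le> m \<and> m < N \<and> m \<le> n. \<Sum>ns\<in>bounded_chains ?r N A m. term_at N ks A ns / of_nat (N - m))"
    proof (rule sum.cong[OF refl])
      fix A assume A: "A \<in> Pow ?O"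
      hence r: "?r \<in> insert ?r A" "insert ?r A - {?r} = A" using rO by auto
      show "(\<Sum>ns\<in>bounded_chains (Suc ?r) N (insert ?r A) n. term_at N (ks @ [k]) (insert ?r A) ns)
        = (\<Sum>m | 1 \<le> m \<and> m < N \<and> m \<le> n. \<Sum>ns\<in>bounded_chains ?r N A m. term_at N ks A ns / of_nat (N - m))"
        unfolding sum_chains r(2) if_P[OF r(1)]
        by (intro sum.cong refl term_at_append(2)) (use A O in \<open>auto simp: bounded_chains_def\<close>)
    qed
    also have "\<dots> = (\<Sum>m | 1 \<le> m \<and> m < N \<and> m \<le> n. \<Sum>A\<in>Pow ?O. \<Sum>ns\<in>bounded_chains ?r N A m. term_at N ks A ns / of_nat (N - m))"
      by (rule sum.swap)
    also have "\<dots> = (\<Sum>m | 1 \<le> m \<and> m < N \<and> m \<le> n. dsum N (rev ks) m / of_nat (N - m))"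
      by (rule sum.cong) (use snoc in \<open>auto simp flip: sum_divide_distrib\<close>)
    also have "\<dots> = (\<Sum>m\<in>{1..n}. dsum N (rev ks) m / of_nat (N - m))"
      by (rule sum.mono_neutral_left) auto \<comment> \<open>for n = N the extra term has denominator 0, hence value 0\<close>
    finally show ?thesis
      using strict True by (simp add: ones_pos_append sum_Pow_insert[OF finO rO] letter1_def qsum_def)
  qed
qed

text \<open>All entries lie below N, so comparing the last one with the sentinel N adds no
  condition, be it strict or weak.\<close>

lemma zeta_diamond_N_eq_dsum:
  assumes "1 \<le> N" "ks = [] \<or> last ks \<noteq> 1"
  shows "zeta_diamond_N N ks = dsum N (rev ks) N"
proof -
  have "S_set (length ks) N A = bounded_chains (length ks) N A N" if A: "A \<in> Pow (ones_pos ks)" for A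
  proof -
    have "(\<forall>i. Suc i < length ks \<longrightarrow> (if i \<in> A then ns ! i \<le> ns ! Suc i else ns ! i < ns ! Suc i))
      \<longleftrightarrow> (\<forall>i<length ks. if i \<in> A then (ns @ [N]) ! i \<le> (ns @ [N]) ! Suc i else (ns @ [N]) ! i < (ns @ [N]) ! Suc i)"
      (is "?L \<longleftrightarrow> (\<forall>i<_. ?R i)")
      if ns: "length ns = length ks" "set ns \<subseteq> {1..<N}" for ns
    proof
      assume ?L
      show "\<forall>i<length ks. ?R i"
      proof (intro allI impI)
        fix i assume i: "i < length ks"
        show "?R i"
        proof (cases "Suc i < length ks")
          case True
          thus ?thesis using \<open>?L\<close> ns by (simp add: nth_append)
        next
          case False
          hence "Suc i = length ks" using i by simp
          moreover from this have "ns ! i < N" using ns nth_mem[of i ns] by (auto simp del: nth_mem)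
          ultimately show ?thesis using ns by (simp add: nth_append)
        qed
      qed
    next
      assume R: "\<forall>i<length ks. ?R i"
      show ?L
      proof (intro allI impI)
        fix i assume i: "Suc i < length ks"
        hence "(ns @ [N]) ! i = ns ! i" "(ns @ [N]) ! Suc i = ns ! Suc i"
          using ns by (simp_all add: nth_append)
        moreover have "?R i" using R i by simp
        ultimately show "if i \<in> A then ns ! i \<le> ns ! Suc i else ns ! i < ns ! Suc i"
          by (cases "i \<in> A") simp_all
      qed
    qed
    thus ?thesis unfolding S_set_def bounded_chains_def by blast
  qed
  hence "zeta_diamond_N N ks = (\<Sum>A\<in>Pow (ones_pos ks). \<Sum>ns\<in>bounded_chains (length ks) N A N. term_at N ks A ns)"
    unfolding zeta_diamond_N_def term_at_def by simp
  thus ?thesis using chain_sum_eq_dsum[of N N ks] assms by simp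
qed

lemma dsum_eq_mhs: "\<forall>x\<in>set w. 2 \<le> x \<Longrightarrow> dsum N w = mhs w"
proof (induction w)
  case (Cons k w)
  thus ?case by (auto simp: qsum_def fun_eq_iff)
qed auto

lemma zeta_diamond_ge2: "ks \<in> I_ge2 k \<Longrightarrow> zeta_diamond ks = (\<lambda>m. mhs (rev ks) (Suc m))"
proof -
  assume "ks \<in> I_ge2 k"
  hence g: "\<forall>x\<in>set ks. 2 \<le> x" by (simp add: I_ge2_def)
  hence "ks = [] \<or> last ks \<noteq> 1" using last_in_set[of ks] by fastforce
  thus ?thesis using g by (auto simp: zeta_diamond_def zeta_diamond_N_eq_dsum dsum_eq_mhs)
qed

section \<open>The basis and its cardinality\<close>

lemma length_le_sum_list: "\<forall>x\<in>set w. (1::nat) \<le> x \<Longrightarrow> length w \<le> sum_list w"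
  by (induction w) auto

lemma I_ge2_lists: "ks \<in> I_ge2 k \<Longrightarrow> set ks \<subseteq> {1..k} \<and> length ks \<le> k"
  using length_le_sum_list[of ks] member_le_sum_list[of _ ks]
  by (fastforce simp: I_ge2_def weight_def)

lemma finite_I_ge2: "finite (I_ge2 k)"
  by (rule finite_subset[OF _ finite_lists_length_le[of "{1..k}" k]]) (use I_ge2_lists in auto)

lemma mhs_independent:
  assumes "\<And>N. 1 \<le> N \<Longrightarrow> (\<Sum>ks\<in>I_ge2 k. c ks * mhs (rev ks) N) = 0" and ks: "ks \<in> I_ge2 k"
  shows "c ks = 0"
proof -
  \<comment> \<open>The reversed words of \<open>I_ge2 k\<close> are not closed under removal of the
    head. This larger finite set is, and the coefficients are extended to it by 0.\<close>
  let ?W = "{w. set w \<subseteq> {1..k} \<and> length w \<le> k}"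
  let ?P = "\<lambda>w. if rev w \<in> I_ge2 k then [:c (rev w):] else 0"
  have fin: "finite ?W" by (rule finite_lists_length_le) simp
  have "?P (rev ks) = 0"
  proof (rule mhs_poly_independent[where P = ?P, OF fin])
    show "rev ks \<in> ?W" using I_ge2_lists[OF ks] by simp
    show "\<forall>x\<in>set w. 1 \<le> x" if "w \<in> ?W" for w using that by auto
    show "w \<in> ?W" if "l # w \<in> ?W" for l w using that by simp
    fix N :: nat assume N: "1 \<le> N"
    have "(\<Sum>w\<in>?W. poly (?P w) (of_nat N) * mhs w N) = (\<Sum>w\<in>rev ` I_ge2 k. poly (?P w) (of_nat N) * mhs w N)"
    proof (rule sum.mono_neutral_right[OF fin])
      show "rev ` I_ge2 k \<subseteq> ?W" using I_ge2_lists[of _ k] by fastforce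
      show "\<forall>w\<in>?W - rev ` I_ge2 k. poly (?P w) (of_nat N) * mhs w N = 0"
      proof
        fix w assume "w \<in> ?W - rev ` I_ge2 k"
        hence "rev w \<notin> I_ge2 k" by (metis DiffD2 image_eqI rev_rev_ident)
        thus "poly (?P w) (of_nat N) * mhs w N = 0" by simp
      qed
    qed
    also have "\<dots> = (\<Sum>ks\<in>I_ge2 k. c ks * mhs (rev ks) N)"
      by (subst sum.reindex) (auto intro: sum.cong)
    finally show "(\<Sum>w\<in>?W. poly (?P w) (of_nat N) * mhs w N) = 0" using assms(1)[OF N] by simp
  qed
  thus ?thesis using ks by simp
qed

lemma inj_on_zeta_diamond: "inj_on zeta_diamond (I_ge2 k)"
proof (rule inj_onI, rule ccontr)
  fix ks ls assume h: "ks \<in> I_ge2 k" "ls \<in> I_ge2 k" "zeta_diamond ks = zeta_diamond ls" "ks \<noteq> ls"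
  define c :: "nat list \<Rightarrow> rat" where "c x = (if x = ks then 1 else 0) - (if x = ls then 1 else 0)" for x
  have "c ks = 0"
  proof (rule mhs_independent[OF _ h(1)])
    fix N :: nat assume "1 \<le> N"
    then obtain m where N: "N = Suc m" by (cases N) auto
    have "mhs (rev ks) N = mhs (rev ls) N"
      using h(1-3) unfolding N by (simp add: zeta_diamond_ge2 fun_eq_iff)
    moreover have "(\<Sum>x\<in>I_ge2 k. c x * mhs (rev x) N)
        = (\<Sum>x\<in>I_ge2 k. if x = ks then mhs (rev x) N else 0) - (\<Sum>x\<in>I_ge2 k. if x = ls then mhs (rev x) N else 0)"
      unfolding sum_subtractf[symmetric] by (rule sum.cong) (auto simp: c_def)
    ultimately show "(\<Sum>x\<in>I_ge2 k. c x * mhs (rev x) N) = 0"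
      using h finite_I_ge2 by simp
  qed
  thus False using h by (simp add: c_def)
qed

text \<open>The Fibonacci recurrence: a first entry 2 is deleted, a larger one is lowered by one,
  giving indices of weight k - 2 and k - 1.\<close>

lemma card_I_ge2: "1 \<le> k \<Longrightarrow> card (I_ge2 k) = fib (k - 1)"
proof (induction k rule: less_induct)
  case (less k)
  consider "k = 1" | "k = 2" | "k \<ge> 3" using less.prems by linarith
  thus ?case
  proof cases
    case 1
    have "I_ge2 1 = {}"
    proof -
      have "ks \<notin> I_ge2 1" for ks by (cases ks) (auto simp: I_ge2_def weight_def)
      thus ?thesis by auto
    qed
    thus ?thesis using 1 by simp
  next
    case 2
    have "ks \<in> I_ge2 2 \<longleftrightarrow> ks = [2]" for ks
    proof
      assume "ks \<in> I_ge2 2"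
      thus "ks = [2]"
        using length_le_sum_list[of "tl ks"]
        by (cases ks; cases "tl ks") (auto simp: I_ge2_def weight_def)
    qed (simp add: I_ge2_def weight_def)
    hence "I_ge2 2 = {[2]}" by auto
    thus ?thesis using 2 by simp
  next
    case 3
    define inc :: "nat list \<Rightarrow> nat list" where "inc = (\<lambda>ks. Suc (hd ks) # tl ks)"
    have ne: "ks \<noteq> []" if "ks \<in> I_ge2 (k - 1)" for ks
      using that 3 by (auto simp: I_ge2_def weight_def)
    have eq: "I_ge2 k = (#) 2 ` I_ge2 (k - 2) \<union> inc ` I_ge2 (k - 1)"
    proof (intro equalityI subsetI)
      fix ks assume ks: "ks \<in> I_ge2 k"
      then obtain x xs where x: "ks = x # xs" using 3 by (cases ks) (auto simp: I_ge2_def weight_def)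
      show "ks \<in> (#) 2 ` I_ge2 (k - 2) \<union> inc ` I_ge2 (k - 1)"
      proof (cases "x = 2")
        case True
        thus ?thesis using ks x by (auto simp: I_ge2_def weight_def)
      next
        case False
        hence "(x - 1) # xs \<in> I_ge2 (k - 1)" "inc ((x - 1) # xs) = ks"
          using ks x by (auto simp: I_ge2_def weight_def inc_def)
        thus ?thesis by force
      qed
    next
      fix ks assume "ks \<in> (#) 2 ` I_ge2 (k - 2) \<union> inc ` I_ge2 (k - 1)"
      thus "ks \<in> I_ge2 k"
      proof
        assume "ks \<in> (#) 2 ` I_ge2 (k - 2)"
        thus ?thesis using 3 by (auto simp: I_ge2_def weight_def)
      next
        assume "ks \<in> inc ` I_ge2 (k - 1)"
        then obtain ls where ls: "ls \<in> I_ge2 (k - 1)" "ks = inc ls" by auto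
        then obtain x xs where "ls = x # xs" using ne by (cases ls) auto
        thus ?thesis using 3 ls by (auto simp: I_ge2_def weight_def inc_def)
      qed
    qed
    have "inj_on inc (I_ge2 (k - 1))"
      using ne by (auto simp: inj_on_def inc_def list.expand)
    moreover have "(#) 2 ` I_ge2 (k - 2) \<inter> inc ` I_ge2 (k - 1) = {}"
    proof -
      have "hd ls \<noteq> 1" if "ls \<in> I_ge2 (k - 1)" for ls
        using ne[OF that] that by (cases ls) (auto simp: I_ge2_def)
      thus ?thesis by (fastforce simp: inc_def)
    qed
    ultimately have "card (I_ge2 k) = card (I_ge2 (k - 2)) + card (I_ge2 (k - 1))"
      unfolding eq by (simp add: card_Un_disjoint finite_I_ge2 card_image)
    also have "\<dots> = fib (k - 3) + fib (k - 2)"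
      using less.IH[of "k - 2"] less.IH[of "k - 1"] 3 by (simp add: numeral_3_eq_3 numeral_2_eq_2)
    also have "\<dots> = fib (k - 1)"
    proof -
      have "k - 1 = Suc (Suc (k - 3))" "k - 2 = Suc (k - 3)" using 3 by auto
      thus ?thesis by simp
    qed
    finally show ?thesis .
  qed
qed

section \<open>Span, independence and dimension in the space of sequences\<close>

interpretation seq: vector_space sscale
  by unfold_locales (auto simp: sscale_def fun_eq_iff algebra_simps)

lemma sum_fun_at: "(\<Sum>i\<in>A. (f i :: nat \<Rightarrow> rat)) x = (\<Sum>i\<in>A. f i x)"
  by (induction A rule: infinite_finite_induct) auto

text \<open>Entry m of a stored sequence belongs to N = m + 1, so the value at 0 never enters and
  agreement for N \<ge> 1, as in \<open>mspan_cong\<close>, is equality of sequences.\<close>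

lemma mspan_imp_span: "mspan k f \<Longrightarrow> (\<lambda>m. f (Suc m)) \<in> seq.span (zeta_diamond ` I_ge2 k)"
proof (induction rule: mspan.induct)
  case mspan_zero
  show ?case using seq.span_zero by (simp add: zero_fun_def)
next
  case (mspan_add f g)
  show ?case using seq.span_add[OF mspan_add.IH] by (simp add: plus_fun_def)
next
  case (mspan_base w c)
  hence "rev w \<in> I_ge2 k" by (simp add: I_ge2_def weight_def)
  hence "sscale c (zeta_diamond (rev w)) \<in> seq.span (zeta_diamond ` I_ge2 k)"
    by (intro seq.span_scale seq.span_base) auto
  moreover have "sscale c (zeta_diamond (rev w)) = (\<lambda>m. c * mhs w (Suc m))"
    using zeta_diamond_ge2[OF \<open>rev w \<in> I_ge2 k\<close>] by (simp add: sscale_def)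
  ultimately show ?case by simp
next
  case (mspan_cong f g)
  thus ?case by simp
qed

lemma zeta_diamond_in_span:
  assumes "admissible ks" "weight ks = k"
  shows "zeta_diamond ks \<in> seq.span (zeta_diamond ` I_ge2 k)"
proof -
  have "admissible_word (rev ks)" using assms by (auto simp: admissible_word_def admissible_def is_index_def hd_rev)
  hence "mspan k (\<lambda>N. dsum N (rev ks) N)" using dsum_mspan[of "rev ks"] assms(2) by (simp add: weight_def)
  moreover have "zeta_diamond ks = (\<lambda>m. dsum (Suc m) (rev ks) (Suc m))"
    using assms(1) by (auto simp: zeta_diamond_def zeta_diamond_N_eq_dsum admissible_def)
  ultimately show ?thesis using mspan_imp_span by fastforce
qed

lemma independent_zeta_diamond: "\<not> seq.dependent (zeta_diamond ` I_ge2 k)"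
proof
  assume "seq.dependent (zeta_diamond ` I_ge2 k)"
  then obtain u v where v: "v \<in> zeta_diamond ` I_ge2 k" "u v \<noteq> 0"
    and s: "(\<Sum>v\<in>zeta_diamond ` I_ge2 k. sscale (u v) v) = 0"
    using seq.dependent_finite[of "zeta_diamond ` I_ge2 k"] finite_I_ge2 by auto
  then obtain ks where ks: "ks \<in> I_ge2 k" "v = zeta_diamond ks" by auto
  have "u (zeta_diamond ks) = 0"
  proof (rule mhs_independent[OF _ ks(1)])
    fix N :: nat assume "1 \<le> N"
    then obtain m where N: "N = Suc m" by (cases N) auto
    have "(\<Sum>ls\<in>I_ge2 k. u (zeta_diamond ls) * mhs (rev ls) N) = (\<Sum>ls\<in>I_ge2 k. sscale (u (zeta_diamond ls)) (zeta_diamond ls) m)"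
      by (rule sum.cong) (simp_all add: sscale_def zeta_diamond_ge2 N)
    also have "\<dots> = (\<Sum>v\<in>zeta_diamond ` I_ge2 k. sscale (u v) v) m"
      by (simp add: sum_fun_at sum.reindex[OF inj_on_zeta_diamond])
    finally show "(\<Sum>ls\<in>I_ge2 k. u (zeta_diamond ls) * mhs (rev ls) N) = 0" using s by simp
  qed
  thus False using v ks by simp
qed

theorem mainTheorem6:
  fixes k :: nat
  assumes "2 \<le> k"
  shows "\<not> module.dependent sscale (zeta_diamond ` I_ge2 k)
         \<and> module.span sscale (zeta_diamond ` I_ge2 k) = Zdiamond k
         \<and> vector_space.dim sscale (Zdiamond k) = fib (k - 1)"
proof -
  have span: "seq.span (zeta_diamond ` I_ge2 k) = Zdiamond k"
  proof
    have "admissible ks \<and> weight ks = k" if "ks \<in> I_ge2 k" for ks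
    proof -
      have "ks \<noteq> []" using that assms by (auto simp: I_ge2_def weight_def)
      moreover have "\<forall>x\<in>set ks. 1 \<le> x" using that by (fastforce simp: I_ge2_def)
      ultimately show ?thesis using that last_in_set[of ks]
        by (auto simp: I_ge2_def admissible_def is_index_def)
    qed
    thus "seq.span (zeta_diamond ` I_ge2 k) \<subseteq> Zdiamond k"
      unfolding Zdiamond_def by (intro seq.span_mono) auto
    show "Zdiamond k \<subseteq> seq.span (zeta_diamond ` I_ge2 k)"
      unfolding Zdiamond_def
      by (rule seq.span_minimal) (auto intro: zeta_diamond_in_span)
  qed
  moreover have "seq.dim (Zdiamond k) = fib (k - 1)"
    unfolding span[symmetric] seq.dim_span_eq_card_independent[OF independent_zeta_diamond]
    using card_image[OF inj_on_zeta_diamond] card_I_ge2[of k] assms by simp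
  ultimately show ?thesis using independent_zeta_diamond by simp
qed

end
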